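(* Let $(D,M)$ be a complete local integral domain that is not a field, with $\operatorname{char}(D/M)=0$. If $D$ is an AV-domain (or an API-domain), then $D$ is a DVR; consequently $D\cong K[[X]]$, where $K\cong D/M$ is a coefficient field for $D$.
   Context: A local ring is a Noetherian ring with a unique maximal ideal; a complete local ring is one complete in its $M$-adic topology. A coefficient field of a complete local ring $(D,M)$ is a subfield mapping isomorphically onto $D/M$. An integral domain $D$ is an AV-domain (almost valuation domain) if for all nonzero $a,b\in D$ there is a natural number $n$ with $a^n\mid b^n$ or $b^n\mid a^n$ in $D$. $D$ is an API-domain (almost principal ideal domain) if for every nonempty subset $\{d_\alpha\}_{\alpha\in\Lambda}$ of $D\setminus\{0\}$ there is a natural number $n$ such that the ideal $(\{d_\alpha^n\}_{\alpha\in\Lambda})$ is principal. A DVR is a rank-one discrete valuation domain, i.e. a local PID that is not a field. *)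

theory Defs
  imports "HOL-Computational_Algebra.Formal_Power_Series"
begin

definition is_ideal :: "'a::comm_ring_1 set \<Rightarrow> bool" where
  "is_ideal I \<longleftrightarrow> 0 \<in> I \<and> (\<forall>x\<in>I. \<forall>y\<in>I. x + y \<in> I) \<and> (\<forall>a. \<forall>x\<in>I. a * x \<in> I)"

definition ideal_gen :: "'a::comm_ring_1 set \<Rightarrow> 'a set" where
  "ideal_gen A = \<Inter>{I. is_ideal I \<and> A \<subseteq> I}"

definition is_principal_ideal :: "'a::comm_ring_1 set \<Rightarrow> bool" where
  "is_principal_ideal I \<longleftrightarrow> (\<exists>a. I = ideal_gen {a})"

definition is_maximal_ideal :: "'a::comm_ring_1 set \<Rightarrow> bool" where
  "is_maximal_ideal M \<longleftrightarrow> is_ideal M \<and> M \<noteq> UNIV \<and>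
     (\<forall>J. is_ideal J \<and> M \<subseteq> J \<and> J \<noteq> UNIV \<longrightarrow> J = M)"

definition noetherian_ring :: "'a::comm_ring_1 itself \<Rightarrow> bool" where
  "noetherian_ring _ \<longleftrightarrow> (\<forall>I::'a set. is_ideal I \<longrightarrow> (\<exists>S. finite S \<and> I = ideal_gen S))"

definition local_ring_with_max :: "'a::comm_ring_1 set \<Rightarrow> bool" where
  "local_ring_with_max M \<longleftrightarrow> noetherian_ring TYPE('a) \<and> is_maximal_ideal M \<and>
     (\<forall>N. is_maximal_ideal N \<longrightarrow> N = M)"

definition ideal_pow :: "'a::comm_ring_1 set \<Rightarrow> nat \<Rightarrow> 'a set" where
  "ideal_pow M n = ideal_gen {prod_list xs | xs. length xs = n \<and> set xs \<subseteq> M}"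

definition madic_complete :: "'a::comm_ring_1 set \<Rightarrow> bool" where
  "madic_complete M \<longleftrightarrow>
     (\<Inter>k. ideal_pow M k) = {0} \<and>
     (\<forall>x::nat \<Rightarrow> 'a. (\<forall>k. \<exists>N. \<forall>m\<ge>N. \<forall>n\<ge>N. x m - x n \<in> ideal_pow M k) \<longrightarrow>
        (\<exists>L. \<forall>k. \<exists>N. \<forall>n\<ge>N. x n - L \<in> ideal_pow M k))"

definition complete_local_ring :: "'a::comm_ring_1 set \<Rightarrow> bool" where
  "complete_local_ring M \<longleftrightarrow> local_ring_with_max M \<and> madic_complete M"

definition residue_char_zero :: "'a::comm_ring_1 set \<Rightarrow> bool" where
  "residue_char_zero M \<longleftrightarrow> (\<forall>n::nat. n > 0 \<longrightarrow> (of_nat n :: 'a) \<notin> M)"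

definition is_field_ring :: "'a::comm_ring_1 itself \<Rightarrow> bool" where
  "is_field_ring _ \<longleftrightarrow> (0::'a) \<noteq> 1 \<and> (\<forall>x::'a. x \<noteq> 0 \<longrightarrow> x dvd 1)"

definition AV_domain :: "'a::idom itself \<Rightarrow> bool" where
  "AV_domain _ \<longleftrightarrow> (\<forall>a b::'a. a \<noteq> 0 \<and> b \<noteq> 0 \<longrightarrow>
      (\<exists>n::nat. n > 0 \<and> (a ^ n dvd b ^ n \<or> b ^ n dvd a ^ n)))"

definition API_domain :: "'a::idom itself \<Rightarrow> bool" where
  "API_domain _ \<longleftrightarrow> (\<forall>S::'a set. S \<noteq> {} \<and> 0 \<notin> S \<longrightarrow>
      (\<exists>n::nat. n > 0 \<and> is_principal_ideal (ideal_gen ((\<lambda>d. d ^ n) ` S))))"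

definition is_DVR :: "'a::idom itself \<Rightarrow> bool" where
  "is_DVR _ \<longleftrightarrow> (\<exists>M::'a set. is_maximal_ideal M \<and> (\<forall>N. is_maximal_ideal N \<longrightarrow> N = M)) \<and>
      (\<forall>I::'a set. is_ideal I \<longrightarrow> is_principal_ideal I) \<and> \<not> is_field_ring TYPE('a)"

text \<open>Coefficient field of (D,M): a subfield K of D mapping isomorphically onto D/M
  (the composite K \<rightarrow> D \<rightarrow> D/M is a ring map, so bijectivity is the condition).\<close>
definition is_subfield :: "'a::comm_ring_1 set \<Rightarrow> bool" where
  "is_subfield K \<longleftrightarrow> 0 \<in> K \<and> 1 \<in> K \<and> (\<forall>x\<in>K. \<forall>y\<in>K. x + y \<in> K \<and> x - y \<in> K \<and> x * y \<in> K)
     \<and> (\<forall>x\<in>K. x \<noteq> 0 \<longrightarrow> (\<exists>y\<in>K. x * y = 1))"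

definition coefficient_field :: "'a::comm_ring_1 set \<Rightarrow> 'a set \<Rightarrow> bool" where
  "coefficient_field M K \<longleftrightarrow> is_subfield K \<and> (\<forall>d. \<exists>!k. k \<in> K \<and> d - k \<in> M)"

definition fps_over :: "'a::comm_ring_1 set \<Rightarrow> 'a fps set" where
  "fps_over K = {f. \<forall>n. fps_nth f n \<in> K}"

definition iso_to_power_series :: "'a::comm_ring_1 set \<Rightarrow> bool" where
  "iso_to_power_series K \<longleftrightarrow> (\<exists>\<psi> :: 'a fps \<Rightarrow> 'a.
      bij_betw \<psi> (fps_over K) UNIV \<and> \<psi> 1 = 1 \<and>
      (\<forall>f\<in>fps_over K. \<forall>g\<in>fps_over K. \<psi> (f + g) = \<psi> f + \<psi> g \<and> \<psi> (f * g) = \<psi> f * \<psi> g))"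

end

theory Submission
  imports "HOL-Algebra.Algebraic_Closure_Type" Defs
begin

text \<open>The core is that \<open>D\<close> contains every \<open>x\<close> in its fraction field with \<open>x\<^sup>n = c \<in> D\<close>; the AV property then
  makes divisibility on \<open>D\<close> a total preorder, and a Noetherian local domain of this kind is a DVR.

  If \<open>c \<in> M\<close>, then \<open>(1 + x)\<^sup>m \<in> D\<close> for some \<open>m > 0\<close>, and this power is congruent to \<open>1\<close>. As the residue
  characteristic is \<open>0\<close>, Hensel's lemma gives an \<open>m\<close>-th root of it in \<open>D\<close>, and this root equals
  \<open>1 + x\<close> because both are congruent to \<open>1\<close>. If \<open>c\<close> is a unit, Hensel's lemma allows one to assume that
  \<open>c\<close> lies in a coefficient field \<open>K\<close>; then every \<open>x - i\<close> with \<open>i\<close> an integer has a power in \<open>K\<close>.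
  If \<open>x\<close> had another conjugate \<open>y\<close> over \<open>K\<close>, all quotients \<open>(y - i) / (x - i)\<close> would be roots of unity.
  This is refuted at a prime above some \<open>(l, x - i)\<close> with \<open>l\<close> a rational prime: there \<open>y \<equiv> i \<equiv> x\<close>, so that
  \<open>y / x\<close> would be a nontrivial root of unity of order prime to \<open>l\<close> reducing to \<open>1\<close>.\<close>

section \<open>Adjoining a root of an element to a subring\<close>

text \<open>A ring and its extensions are subsets of one ambient type. With an ideal
  \<open>Q\<close> in place of \<open>R\<close>, the values of these polynomials at \<open>y\<close>
  form the ideal that \<open>Q\<close> generates in the extension by \<open>y\<close>.\<close>

definition polys_over :: "'a::comm_ring_1 set \<Rightarrow> 'a poly set" where
  "polys_over R = {p. \<forall>i. coeff p i \<in> R}"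

definition ring_adjoin :: "'a::comm_ring_1 set \<Rightarrow> 'a \<Rightarrow> 'a set" where
  "ring_adjoin R y = (\<lambda>p. poly p y) ` polys_over R"

definition is_subring :: "'a::comm_ring_1 set \<Rightarrow> bool" where
  "is_subring R \<longleftrightarrow> 0 \<in> R \<and> 1 \<in> R \<and> (\<forall>x\<in>R. \<forall>y\<in>R. x + y \<in> R \<and> x - y \<in> R \<and> x * y \<in> R)"

definition ideal_of :: "'a::comm_ring_1 set \<Rightarrow> 'a set \<Rightarrow> bool" where
  "ideal_of R P \<longleftrightarrow> P \<subseteq> R \<and> 0 \<in> P \<and> (\<forall>x\<in>P. \<forall>y\<in>P. x + y \<in> P) \<and> (\<forall>a\<in>R. \<forall>x\<in>P. a * x \<in> P)"

definition prime_ideal_of :: "'a::comm_ring_1 set \<Rightarrow> 'a set \<Rightarrow> bool" where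
  "prime_ideal_of R Q \<longleftrightarrow> ideal_of R Q \<and> 1 \<notin> Q \<and> (\<forall>x\<in>R. \<forall>y\<in>R. x * y \<in> Q \<longrightarrow> x \<in> Q \<or> y \<in> Q)"

lemma is_subringD:
  assumes "is_subring R"
  shows "0 \<in> R" "1 \<in> R"
    "x \<in> R \<Longrightarrow> y \<in> R \<Longrightarrow> x + y \<in> R"
    "x \<in> R \<Longrightarrow> y \<in> R \<Longrightarrow> x - y \<in> R"
    "x \<in> R \<Longrightarrow> y \<in> R \<Longrightarrow> x * y \<in> R"
    "x \<in> R \<Longrightarrow> - x \<in> R"
  using assms unfolding is_subring_def by (auto simp flip: diff_0)

lemma is_subring_power:
  "is_subring R \<Longrightarrow> x \<in> R \<Longrightarrow> x ^ n \<in> R"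
  by (induction n) (auto intro: is_subringD)

lemma is_subring_of_nat: "is_subring R \<Longrightarrow> of_nat n \<in> R"
  by (induction n) (auto intro: is_subringD)

lemma is_subring_of_int: "is_subring R \<Longrightarrow> of_int k \<in> R"
  by (cases k rule: int_cases2) (auto intro: is_subringD is_subring_of_nat)

lemma ideal_ofD:
  assumes "ideal_of R P"
  shows "P \<subseteq> R" "x \<in> P \<Longrightarrow> x \<in> R" "0 \<in> P"
    "x \<in> P \<Longrightarrow> y \<in> P \<Longrightarrow> x + y \<in> P"
    "a \<in> R \<Longrightarrow> x \<in> P \<Longrightarrow> a * x \<in> P"
    "a \<in> R \<Longrightarrow> x \<in> P \<Longrightarrow> x * a \<in> P"
  using assms unfolding ideal_of_def by (auto simp: mult.commute)

lemma ideal_of_diff: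
  assumes "is_subring R" "ideal_of R P" "x \<in> P" "y \<in> P"
  shows "x - y \<in> P"
proof -
  have "x + (- 1) * y \<in> P"
    using assms by (intro ideal_ofD(4)[OF assms(2)] ideal_ofD(5)[OF assms(2)]) (auto intro: is_subringD)
  then show ?thesis by simp
qed

lemma ideal_of_sum:
  "ideal_of R P \<Longrightarrow> (\<And>i. i \<in> A \<Longrightarrow> f i \<in> P) \<Longrightarrow> sum f A \<in> P"
  by (induction A rule: infinite_finite_induct) (auto intro: ideal_ofD)

lemma prime_ideal_of_power:
  assumes "is_subring R" "prime_ideal_of R Q" "x \<in> R" "x ^ n \<in> Q"
  shows "x \<in> Q"
  using assms(4)
proof (induction n)
  case 0
  then show ?case using assms(2) by (simp add: prime_ideal_of_def)
next
  case (Suc n)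
  then have "x \<in> Q \<or> x ^ n \<in> Q"
    using assms(1-3) by (auto simp: prime_ideal_of_def is_subring_power)
  with Suc.IH show ?case by blast
qed

lemma polys_over_pCons [simp]: "pCons a p \<in> polys_over R \<longleftrightarrow> a \<in> R \<and> p \<in> polys_over R"
proof
  assume p: "pCons a p \<in> polys_over R"
  have "coeff (pCons a p) 0 \<in> R" "coeff (pCons a p) (Suc i) \<in> R" for i
    using p unfolding polys_over_def by blast+
  then show "a \<in> R \<and> p \<in> polys_over R" by (auto simp: polys_over_def)
qed (auto simp: polys_over_def coeff_pCons split: nat.split)

lemma polys_over_0: "0 \<in> R \<Longrightarrow> 0 \<in> polys_over R"
  by (simp add: polys_over_def)

lemma polys_over_mult_ideal:
  assumes "ideal_of R Q" "p \<in> polys_over R" "q \<in> polys_over Q"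
  shows "p * q \<in> polys_over Q"
  using assms unfolding polys_over_def
  by (auto simp: coeff_mult intro!: ideal_of_sum[OF assms(1)] ideal_ofD(5)[OF assms(1)])

lemma ideal_of_refl: "is_subring R \<Longrightarrow> ideal_of R R"
  by (auto simp: ideal_of_def is_subring_def)

lemma is_subring_polys_over: "is_subring R \<Longrightarrow> is_subring (polys_over R)"
  unfolding is_subring_def[of "polys_over R"]
  using polys_over_mult_ideal[OF ideal_of_refl]
  by (auto simp: polys_over_def coeff_1 intro: is_subringD)

lemma polys_over_monom: "0 \<in> R \<Longrightarrow> a \<in> R \<Longrightarrow> monom a n \<in> polys_over R"
  by (auto simp: polys_over_def)

lemma is_subring_ring_adjoin:
  assumes "is_subring R" shows "is_subring (ring_adjoin R y)"
proof -
  have S: "is_subring (polys_over R)" by (rule is_subring_polys_over[OF assms])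
  show ?thesis
    unfolding is_subring_def ring_adjoin_def
  proof (intro conjI ballI)
    show "0 \<in> (\<lambda>p. poly p y) ` polys_over R"
      using is_subringD(1)[OF S] by (force intro: image_eqI[where x = 0])
    show "1 \<in> (\<lambda>p. poly p y) ` polys_over R"
      using is_subringD(2)[OF S] by (force intro: image_eqI[where x = 1])
  qed (auto simp flip: poly_add poly_diff poly_mult intro!: imageI is_subringD[OF S])
qed

lemma ring_adjoin_base: "0 \<in> R \<Longrightarrow> a \<in> R \<Longrightarrow> a \<in> ring_adjoin R y"
  unfolding ring_adjoin_def by (force intro: image_eqI[where x = "[:a:]"] simp: polys_over_0)

lemma ring_adjoin_gen: "is_subring R \<Longrightarrow> y \<in> ring_adjoin R y"
  unfolding ring_adjoin_def
  by (force intro: image_eqI[where x = "[:0, 1:]"] simp: polys_over_0 is_subringD)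

text \<open>Nakayama's lemma at the prime \<open>Q\<close>, by fraction-free elimination.\<close>

lemma nakayama_elimination:
  fixes v :: "nat \<Rightarrow> 'a::idom"
  assumes R: "is_subring R" and Q: "prime_ideal_of R Q"
  shows "w \<in> R \<Longrightarrow> w \<notin> Q \<Longrightarrow> (\<And>k j. q k j \<in> Q) \<Longrightarrow>
    (\<And>k. k < n \<Longrightarrow> w * v k = (\<Sum>j<n. q k j * v j)) \<Longrightarrow> k < n \<Longrightarrow> v k = 0"
proof (induction n arbitrary: w q k)
  case 0
  then show ?case by simp
next
  case (Suc n)
  have Qi: "ideal_of R Q" using Q by (simp add: prime_ideal_of_def)
  \<comment> \<open>The last equation now reads \<open>w' * v n = (\<Sum>j<n. q n j * v j)\<close>.
    As \<open>w'\<close> is still outside \<open>Q\<close>, multiplying the other rows by it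
    eliminates \<open>v n\<close> without a division.\<close>
  define w' where "w' = w - q n n"
  have qR: "q i j \<in> R" for i j using ideal_ofD(2)[OF Qi] Suc.prems(3) by blast
  have w'R: "w' \<in> R" unfolding w'_def by (intro is_subringD[OF R] Suc.prems qR)
  have w'Q: "w' \<notin> Q"
  proof
    assume "w' \<in> Q"
    then have "w' + q n n \<in> Q" by (intro ideal_ofD(4)[OF Qi] Suc.prems)
    then show False using Suc.prems(2) by (simp add: w'_def)
  qed
  have n: "w' * v n = (\<Sum>j<n. q n j * v j)"
    using Suc.prems(4)[of n] by (simp add: w'_def algebra_simps)
  have IH: "v k = 0" if "k < n" for k
  proof (rule Suc.IH[where w = "w' * w" and q = "\<lambda>k j. w' * q k j + q k n * q n j"])
    show "w' * w \<in> R" by (intro is_subringD[OF R] w'R Suc.prems)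
    show "w' * w \<notin> Q" using Q w'R w'Q Suc.prems(1,2) by (auto simp: prime_ideal_of_def)
    show "w' * q k j + q k n * q n j \<in> Q" for k j
      by (intro ideal_ofD(4)[OF Qi] ideal_ofD(5)[OF Qi] w'R qR Suc.prems)
    show "k < n" by (rule that)
    fix k assume "k < n"
    then have "w' * w * v k = w' * (\<Sum>j<Suc n. q k j * v j)"
      using Suc.prems(4)[of k] by (simp add: mult.assoc)
    also have "\<dots> = w' * (\<Sum>j<n. q k j * v j) + q k n * (w' * v n)"
      by (simp add: algebra_simps)
    also have "\<dots> = (\<Sum>j<n. (w' * q k j + q k n * q n j) * v j)"
      unfolding n by (simp add: sum_distrib_left sum.distrib algebra_simps)
    finally show "w' * w * v k = (\<Sum>j<n. (w' * q k j + q k n * q n j) * v j)" .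
  qed
  have "w' * v n = 0" unfolding n using IH by simp
  moreover have "w' \<noteq> 0" using w'Q ideal_ofD(3)[OF Qi] by auto
  ultimately have "v n = 0" by simp
  with IH Suc.prems(5) show ?case by (cases "k = n") auto
qed

text \<open>Since \<open>y ^ Suc m\<close> is a scalar from \<open>R\<close>, Horner's scheme never
  needs a power of \<open>y\<close> above \<open>m\<close>: the top coefficient wraps around to the
  constant term and stays in \<open>Q\<close>.\<close>

lemma poly_root_of_power_reduce:
  assumes Q: "ideal_of R Q" and c: "y ^ Suc m \<in> R" and p: "p \<in> polys_over Q"
  shows "\<exists>q. (\<forall>j. q j \<in> Q) \<and> poly p y = (\<Sum>j<Suc m. q j * y ^ j)"
  using p
proof (induction p)
  case 0
  then show ?case using ideal_ofD(3)[OF Q] by (intro exI[of _ "\<lambda>_. 0"]) auto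
next
  case (pCons a p)
  then obtain q where q: "\<And>j. q j \<in> Q" "poly p y = (\<Sum>j<Suc m. q j * y ^ j)" by auto
  define q' where "q' = (\<lambda>j. case j of 0 \<Rightarrow> a + y ^ Suc m * q m | Suc j \<Rightarrow> q j)"
  have "q' j \<in> Q" for j
    using q(1) c pCons.prems by (auto simp: q'_def split: nat.split simp del: power_Suc
        intro!: ideal_ofD(4)[OF Q] ideal_ofD(5)[OF Q])
  moreover have "poly (pCons a p) y = (\<Sum>j<Suc m. q' j * y ^ j)"
  proof -
    have "(\<Sum>j<Suc m. q' j * y ^ j) = a + y ^ Suc m * q m + (\<Sum>j<m. q j * y ^ Suc j)"
      by (subst sum.lessThan_Suc_shift) (simp add: q'_def)
    then show ?thesis by (simp add: q(2) algebra_simps sum_distrib_left)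
  qed
  ultimately show ?case by blast
qed

text \<open>If \<open>w = poly p y\<close> were outside \<open>Q\<close>, then multiplication by
  \<open>w\<close> would send each power of \<open>y\<close> into the span of
  \<open>y ^ 0, ..., y ^ m\<close> with coefficients in \<open>Q\<close>, and elimination would give
  \<open>y ^ 0 = 0\<close>.\<close>

lemma lying_over:
  fixes y :: "'a::idom"
  assumes R: "is_subring R" and Q: "prime_ideal_of R Q" and n: "n > 0" and c: "y ^ n \<in> R"
    and p: "p \<in> polys_over Q" "poly p y \<in> R"
  shows "poly p y \<in> Q"
proof (rule ccontr)
  assume w: "poly p y \<notin> Q"
  have Qi: "ideal_of R Q" using Q by (simp add: prime_ideal_of_def)
  obtain m where m: "n = Suc m" using n by (cases n) auto
  have "\<exists>q. (\<forall>j. q j \<in> Q) \<and> poly (monom 1 k * p) y = (\<Sum>j<Suc m. q j * y ^ j)" for k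
    using c R p(1) unfolding m
    by (intro poly_root_of_power_reduce[OF Qi] polys_over_mult_ideal[OF Qi] polys_over_monom)
      (auto intro: is_subringD)
  then obtain q where q: "\<And>k j. q k j \<in> Q"
    "\<And>k. poly (monom 1 k * p) y = (\<Sum>j<Suc m. q k j * y ^ j)" by metis
  have "y ^ 0 = 0"
    by (rule nakayama_elimination[OF R Q p(2) w, of q n "\<lambda>k. y ^ k" 0])
      (use q n in \<open>auto simp: m poly_monom mult.commute simp del: sum.lessThan_Suc\<close>)
  then show False by simp
qed

text \<open>The radical of the ideal generated by \<open>Q\<close> in the extension takes the place
  of a prime above \<open>Q\<close>: it is closed under roots, and it contracts into
  \<open>Q\<close> because \<open>Q\<close> is prime.\<close>

lemma lying_over_radical_ideal:
  fixes y :: "'a::idom"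
  assumes R: "is_subring R" and Q: "prime_ideal_of R Q" and n: "n > 0" and c: "y ^ n \<in> R"
  obtains P where "ideal_of (ring_adjoin R y) P" "Q \<subseteq> P" "P \<inter> R \<subseteq> Q"
    "\<And>z N. z \<in> ring_adjoin R y \<Longrightarrow> z ^ N \<in> P \<Longrightarrow> z \<in> P"
proof -
  define A where "A = ring_adjoin R y"
  define J where "J = (\<lambda>p. poly p y) ` polys_over Q"
  have A: "is_subring A" unfolding A_def by (rule is_subring_ring_adjoin[OF R])
  have Qi: "ideal_of R Q" using Q by (simp add: prime_ideal_of_def)
  have J: "ideal_of A J"
    unfolding ideal_of_def
  proof (intro conjI ballI)
    show "J \<subseteq> A" using ideal_ofD(1)[OF Qi] by (auto simp: J_def A_def ring_adjoin_def polys_over_def)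
    show "0 \<in> J" unfolding J_def using ideal_ofD(3)[OF Qi]
      by (intro image_eqI[where x = 0]) (auto simp: polys_over_0)
    show "x + z \<in> J" if "x \<in> J" "z \<in> J" for x z
      using that unfolding J_def
      by (auto simp flip: poly_add simp: polys_over_def intro!: imageI ideal_ofD(4)[OF Qi])
    show "a * x \<in> J" if "a \<in> A" "x \<in> J" for a x
      using that unfolding J_def A_def ring_adjoin_def
      by (auto simp flip: poly_mult intro!: imageI polys_over_mult_ideal[OF Qi])
  qed
  define P where "P = {z \<in> A. \<exists>N>0. z ^ N \<in> J}"
  have P: "ideal_of A P"
    unfolding ideal_of_def
  proof (intro conjI ballI)
    show "P \<subseteq> A" by (auto simp: P_def)
    show "0 \<in> P" unfolding P_def
      using ideal_ofD(3)[OF J] is_subringD(1)[OF A] by (auto intro!: exI[of _ 1])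
    show "a * x \<in> P" if "a \<in> A" "x \<in> P" for a x
      using that unfolding P_def power_mult_distrib
      by (auto simp: power_mult_distrib intro!: is_subringD(5)[OF A] ideal_ofD(5)[OF J] is_subring_power[OF A])
    fix u v assume "u \<in> P" "v \<in> P"
    then obtain m k where uv: "u \<in> A" "v \<in> A" "m > 0" "k > 0" "u ^ m \<in> J" "v ^ k \<in> J"
      by (auto simp: P_def)
    have "(u + v) ^ (m + k) \<in> J"
      unfolding binomial_ring
    proof (rule ideal_of_sum[OF J])
      fix i assume i: "i \<in> {..m + k}"
      have "u ^ i * v ^ (m + k - i) \<in> J"
      proof (cases "m \<le> i")
        case True
        then have "u ^ i = u ^ m * u ^ (i - m)" by (simp flip: power_add)
        then show ?thesis
          using uv by (auto intro!: ideal_ofD(6)[OF J] is_subring_power[OF A])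
      next
        case False
        then have "v ^ (m + k - i) = v ^ k * v ^ (m - i)" by (simp add: add.commute flip: power_add)
        then show ?thesis
          using ideal_ofD(5)[OF J is_subring_power[OF A uv(1)] ideal_ofD(6)[OF J is_subring_power[OF A uv(2)] uv(6)]]
          by simp
      qed
      then show "of_nat ((m + k) choose i) * u ^ i * v ^ (m + k - i) \<in> J"
        using ideal_ofD(5)[OF J is_subring_of_nat[OF A]] by (simp only: mult.assoc)
    qed
    then show "u + v \<in> P" using uv is_subringD(3)[OF A]
      by (auto simp: P_def intro!: exI[of _ "m + k"])
  qed
  show thesis
  proof (rule that[of P])
    show "ideal_of (ring_adjoin R y) P" using P by (simp add: A_def)
    show "Q \<subseteq> P"
    proof
      fix a assume a: "a \<in> Q"
      then have "a \<in> J" unfolding J_def using ideal_ofD(3)[OF Qi]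
        by (intro image_eqI[where x = "[:a:]"]) (auto simp: polys_over_0)
      then show "a \<in> P" using ideal_ofD(2)[OF J] by (auto simp: P_def intro!: exI[of _ 1])
    qed
    show "P \<inter> R \<subseteq> Q"
    proof
      fix a assume "a \<in> P \<inter> R"
      then obtain N where N: "a \<in> R" "a ^ N \<in> J" by (auto simp: P_def)
      then have "a ^ N \<in> Q"
        using lying_over[OF R Q n c] is_subring_power[OF R, of a N] by (auto simp: J_def)
      then show "a \<in> Q" using prime_ideal_of_power[OF R Q N(1)] by blast
    qed
    show "z \<in> P" if zN: "z \<in> ring_adjoin R y" "z ^ N \<in> P" for z N
    proof -
      obtain k where k: "k > 0" "z ^ (N * k) \<in> J"
        using zN(2) by (auto simp: P_def power_mult)
      show ?thesis
      proof (cases "N = 0")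
        case False
        then show ?thesis using k zN by (auto simp: P_def A_def intro!: exI[of _ "N * k"])
      next
        case True
        then have "1 \<in> P" using zN by simp
        then have "z * 1 \<in> P" using zN by (intro ideal_ofD(5)[OF P]) (auto simp: A_def)
        then show ?thesis by simp
      qed
    qed
  qed
qed

section \<open>Translates by integers with common powers\<close>

lemma map_poly_of_int_add:
  "map_poly (of_int :: int \<Rightarrow> 'a::comm_ring_1) (p + q) = map_poly of_int p + map_poly of_int q"
  by (rule poly_eqI) (simp add: coeff_map_poly)

lemma map_poly_of_int_diff:
  "map_poly (of_int :: int \<Rightarrow> 'a::comm_ring_1) (p - q) = map_poly of_int p - map_poly of_int q"
  by (rule poly_eqI) (simp add: coeff_map_poly)

lemma map_poly_of_int_mult:
  "map_poly (of_int :: int \<Rightarrow> 'a::comm_ring_1) (p * q) = map_poly of_int p * map_poly of_int q"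
  by (rule poly_eqI) (simp add: coeff_map_poly coeff_mult)

lemma of_int_eq_0_charD:
  assumes "\<And>n::nat. n > 0 \<Longrightarrow> of_nat n \<noteq> (0::'a::ring_1)" "(of_int k :: 'a) = 0"
  shows "k = 0"
  using assms by (cases k rule: int_cases2) fastforce+

text \<open>The map \<open>x \<mapsto> j\<close> yields a ring homomorphism from \<open>\<int>[x]\<close> to the field with \<open>l\<close> elements.
  When \<open>x\<close> is algebraic over the rationals, \<open>l\<close> is a prime factor of a value at \<open>j\<close> of the minimal
  polynomial of \<open>x\<close>.\<close>

lemma exists_residue_degree_one_prime:
  fixes x :: "'a::idom" and N :: int
  assumes char: "\<And>n::nat. n > 0 \<Longrightarrow> of_nat n \<noteq> (0::'a)" and x: "x \<noteq> 0" and N: "N \<noteq> 0"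
  obtains l j :: int where "prime l" "\<not> l dvd j" "\<not> l dvd N"
    "\<And>G. poly (map_poly of_int G) x = 0 \<Longrightarrow> l dvd poly G j"
proof (cases "\<exists>f::int poly. f \<noteq> 0 \<and> poly (map_poly of_int f) x = 0")
  case False
  \<comment> \<open>As \<open>x\<close> satisfies no nontrivial integer relation, any residue
    \<open>j\<close> is admissible. The choice \<open>j = 1\<close> is prime to every
    \<open>l\<close>, and a prime above \<open>\<bar>N\<bar>\<close> cannot divide
    \<open>N\<close>.\<close>
  obtain p :: nat where p: "prime p" "p > nat \<bar>N\<bar>" using bigger_prime by blast
  show thesis
  proof (rule that[of "int p" 1])
    show "prime (int p)" using p by simp
    show "\<not> int p dvd 1" using p by auto
    show "\<not> int p dvd N"
    proof
      assume "int p dvd N"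
      then have "\<bar>int p\<bar> \<le> \<bar>N\<bar>" using N by (rule dvd_imp_le_int[rotated])
      then show False using p by simp
    qed
    show "int p dvd poly G 1" if "poly (map_poly of_int G) x = 0" for G
    proof -
      have "G = 0" using False that by blast
      then show ?thesis by simp
    qed
  qed
next
  case True
  define Z where "Z = (\<lambda>f::int poly. f \<noteq> 0 \<and> poly (map_poly of_int f) x = 0)"
  obtain f where f: "Z f" "\<And>g. Z g \<Longrightarrow> degree f \<le> degree g"
    using True ex_has_least_nat[of Z _ degree] unfolding Z_def by blast
  have f0: "f \<noteq> 0" and fx: "poly (map_poly of_int f) x = 0" using f(1) by (auto simp: Z_def)
  obtain c g where fg: "f = pCons c g" by (cases f) auto
  have g0: "g \<noteq> 0"
  proof
    assume "g = 0"
    then have "of_int c = (0::'a)" "c \<noteq> 0" using fx f0 by (auto simp: fg map_poly_pCons)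
    then show False using of_int_eq_0_charD[OF char] by auto
  qed
  have c: "c \<noteq> 0"
  proof
    assume "c = 0"
    then have "Z g" using fx x g0 by (simp add: fg Z_def map_poly_pCons)
    then show False using f(2)[of g] g0 by (simp add: fg)
  qed
  define a where "a = lead_coeff f"
  have a: "a \<noteq> 0" using f0 by (simp add: a_def)
  \<comment> \<open>With \<open>poly f i = c * u\<close> as below, these are the arguments for which
    \<open>u\<close> is zero or a unit.\<close>
  define B where "B = {i. poly f i = c} \<union> {i. poly f i = - c} \<union> {i. poly f i = 0}"
  have fin: "finite {i. poly f i = d}" for d
  proof -
    have "f - [:d:] \<noteq> 0" using g0 by (simp add: fg)
    then have "finite {i. poly (f - [:d:]) i = 0}" by (rule poly_roots_finite)
    then show ?thesis by simp
  qed
  have "finite B" unfolding B_def using fin by blast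
  \<comment> \<open>Arguments of this form turn \<open>poly f i\<close> into
    \<open>c * (1 + m * poly g i)\<close> with \<open>m = a * N * c * s\<close>. A prime divisor
    \<open>l\<close> of the bracket is prime to \<open>m\<close>, hence to \<open>a\<close>,
    \<open>N\<close> and \<open>i = c * m\<close>. Infinitely many arguments are available, so one
    avoids \<open>B\<close>.\<close>
  have inj: "inj (\<lambda>s::int. c * (a * N * c * s))" using a c N by (auto simp: inj_def)
  have "infinite (range (\<lambda>s::int. c * (a * N * c * s)))"
    using inj by (simp add: finite_image_iff infinite_UNIV_int)
  then have "\<not> range (\<lambda>s::int. c * (a * N * c * s)) \<subseteq> B"
    using finite_subset[OF _ \<open>finite B\<close>] by blast
  then obtain i where i: "i \<in> range (\<lambda>s::int. c * (a * N * c * s))" "i \<notin> B" by blast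
  then obtain s where s: "i = c * (a * N * c * s)" by blast
  define m where "m = a * N * c * s"
  define u where "u = 1 + m * poly g i"
  have fi: "poly f i = c * u" by (simp add: fg u_def s m_def algebra_simps)
  have "u \<noteq> 0" "u \<noteq> 1" "u \<noteq> - 1" using i(2) fi by (auto simp: B_def)
  then have "\<not> is_unit u" by auto
  then obtain l where l: "prime l" "l dvd u"
    using prime_divisor_exists[OF \<open>u \<noteq> 0\<close>] by auto
  have lm: "\<not> l dvd m"
  proof
    assume "l dvd m"
    then have "l dvd u - m * poly g i" using l by (intro dvd_diff) auto
    then show False using l by (auto simp: u_def)
  qed
  show thesis
  proof (rule that[of l i])
    show "prime l" by (rule l)
    show "\<not> l dvd N" using lm by (auto simp: m_def)
    show "\<not> l dvd i" using lm l(1) s by (auto simp: m_def prime_dvd_mult_iff)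
    fix G assume G: "poly (map_poly of_int G) x = 0"
    \<comment> \<open>Pseudo-division multiplies \<open>G\<close> by a power of \<open>a\<close>,
      which \<open>l\<close> does not divide, and minimality of \<open>degree f\<close> kills the
      remainder. So \<open>l\<close> divides \<open>poly G i\<close> because it divides
      \<open>poly f i\<close>.\<close>
    obtain q r where qr: "pseudo_divmod G f = (q, r)" by (cases "pseudo_divmod G f")
    define e where "e = a ^ (Suc (degree G) - degree f)"
    have eq: "smult e G = f * q + r" and deg: "r = 0 \<or> degree r < degree f"
      using pseudo_divmod[OF f0 qr] by (auto simp: e_def a_def)
    have "poly (map_poly of_int (smult e G - f * q)) x = 0"
      using G fx by (simp add: map_poly_of_int_diff map_poly_of_int_mult map_poly_smult)
    then have "\<not> (r \<noteq> 0 \<and> degree r < degree f)" using f(2)[of r] eq by (auto simp: Z_def)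
    then have "smult e G = f * q" using eq deg by auto
    then have "e * poly G i = poly f i * poly q i" by (metis poly_mult poly_smult)
    then have "l dvd e * poly G i" using l(2) fi by simp
    moreover have "\<not> l dvd e"
      using lm l(1) prime_dvd_power[of l a] unfolding e_def m_def by (auto simp: prime_dvd_mult_iff)
    ultimately show "l dvd poly G i" using l(1) by (simp add: prime_dvd_mult_iff)
  qed
qed

text \<open>At a place over \<open>(l, x - j)\<close> the element \<open>y\<close> specialises to the same value as \<open>x\<close>. But \<open>y / x\<close>
  is a root of unity of order prime to \<open>l\<close>, which can reduce to \<open>1\<close> only if it equals \<open>1\<close>.\<close>

theorem eq_if_all_translates_power_eq:
  fixes x y :: "'a::idom"
  assumes char: "\<And>n::nat. n > 0 \<Longrightarrow> of_nat n \<noteq> (0::'a)"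
    and pow: "\<And>i::int. \<exists>N>0. (x - of_int i) ^ N = (y - of_int i) ^ N"
  shows "x = y"
proof (rule ccontr)
  assume neq: "x \<noteq> y"
  obtain N where N: "N > 0" "x ^ N = y ^ N" using pow[of 0] by auto
  have x: "x \<noteq> 0"
  proof
    assume "x = 0"
    then have "y ^ N = 0" using N by (simp add: power_0_left)
    then show False using \<open>x = 0\<close> neq by simp
  qed
  obtain l j :: int where l: "prime l" "\<not> l dvd j" "\<not> l dvd int N"
    and lj: "\<And>G. poly (map_poly of_int G) x = 0 \<Longrightarrow> l dvd poly G j"
    using exists_residue_degree_one_prime[OF char x, of "int N"] N(1) by auto
  define ev :: "int poly \<Rightarrow> 'a" where "ev = (\<lambda>G. poly (map_poly of_int G) x)"
  have ev: "ev (p + q) = ev p + ev q" "ev (p - q) = ev p - ev q" "ev (p * q) = ev p * ev q"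
    "ev 0 = 0" "ev 1 = 1" for p q
    by (simp_all add: ev_def map_poly_of_int_add map_poly_of_int_diff map_poly_of_int_mult)
  \<comment> \<open>\<open>R\<close> is the ring of integer polynomials in \<open>x\<close>, and
    \<open>Q\<close> is the kernel of the map to the integers modulo \<open>l\<close> that sends
    \<open>x\<close> to \<open>j\<close>; the fact \<open>lj\<close> makes this map well
    defined.\<close>
  define R where "R = range ev"
  define Q where "Q = {ev G | G. l dvd poly G j}"
  have Q_iff: "ev G \<in> Q \<longleftrightarrow> l dvd poly G j" for G
  proof
    assume "ev G \<in> Q"
    then obtain H where H: "ev G = ev H" "l dvd poly H j" by (auto simp: Q_def)
    then have "ev (G - H) = 0" by (simp add: ev)
    then have "l dvd poly (G - H) j" unfolding ev_def by (rule lj)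
    then have "l dvd poly (G - H) j + poly H j" using H(2) by (rule dvd_add)
    then show "l dvd poly G j" by simp
  qed (auto simp: Q_def)
  have R: "is_subring R"
    unfolding is_subring_def R_def
  proof (intro conjI ballI)
    show "0 \<in> range ev" using rangeI[of ev 0] by (simp only: ev)
    show "1 \<in> range ev" using rangeI[of ev 1] by (simp only: ev)
  qed (auto simp flip: ev(1-3))
  have Q: "prime_ideal_of R Q"
    unfolding prime_ideal_of_def ideal_of_def
  proof (intro conjI ballI impI)
    show "Q \<subseteq> R" by (auto simp: Q_def R_def)
    show "0 \<in> Q" using Q_iff[of 0] by (simp add: ev)
    show "1 \<notin> Q" using Q_iff[of 1] l(1) by (auto simp: ev)
    show "u + v \<in> Q" if uv: "u \<in> Q" "v \<in> Q" for u v
    proof -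
      obtain G H where "u = ev G" "v = ev H" "l dvd poly G j" "l dvd poly H j"
        using uv by (auto simp: Q_def)
      then show ?thesis using Q_iff[of "G + H"] by (simp add: ev)
    qed
    show "a * u \<in> Q" if uv: "a \<in> R" "u \<in> Q" for a u
    proof -
      obtain G H where "a = ev G" "u = ev H" "l dvd poly H j"
        using uv by (auto simp: Q_def R_def)
      then show ?thesis using Q_iff[of "G * H"] by (simp add: ev)
    qed
    show "u \<in> Q \<or> v \<in> Q" if uv: "u \<in> R" "v \<in> R" "u * v \<in> Q" for u v
    proof -
      obtain G H where GH: "u = ev G" "v = ev H" using uv by (auto simp: R_def)
      then have "l dvd poly (G * H) j" using uv(3) Q_iff[of "G * H"] by (simp add: ev)
      then show ?thesis using GH l(1) Q_iff by (simp add: prime_dvd_mult_iff)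
    qed
  qed
  have xR: "x = ev [:0, 1:]" by (simp add: ev_def map_poly_pCons)
  have "y ^ N \<in> R" using N(2) R unfolding R_def by (metis xR is_subring_power rangeI)
  then obtain P where P: "ideal_of (ring_adjoin R y) P" "Q \<subseteq> P" "P \<inter> R \<subseteq> Q"
    and rad: "\<And>z N. z \<in> ring_adjoin R y \<Longrightarrow> z ^ N \<in> P \<Longrightarrow> z \<in> P"
    using lying_over_radical_ideal[OF R Q N(1)] by blast
  define A where "A = ring_adjoin R y"
  have A: "is_subring A" unfolding A_def by (rule is_subring_ring_adjoin[OF R])
  have RA: "R \<subseteq> A" unfolding A_def using ring_adjoin_base is_subringD(1)[OF R] by blast
  have xA: "x \<in> A" using RA xR by (auto simp: R_def)
  have yA: "y \<in> A" unfolding A_def by (rule ring_adjoin_gen[OF R])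
  have jA: "of_int j \<in> A" by (rule is_subring_of_int[OF A])
  have xj: "x - of_int j \<in> P"
  proof -
    have "ev [:-j, 1:] \<in> Q" unfolding Q_iff by simp
    then show ?thesis using P(2) by (auto simp: ev_def map_poly_pCons)
  qed
  have yj: "y - of_int j \<in> P"
  proof -
    obtain k where k: "k > 0" "(x - of_int j) ^ k = (y - of_int j) ^ k" using pow by blast
    then have "(x - of_int j) ^ k = (x - of_int j) ^ (k - 1) * (x - of_int j)"
      by (simp flip: power_Suc2)
    also have "\<dots> \<in> P"
      using xj xA jA A by (intro ideal_ofD(5)[OF P(1)]) (auto simp flip: A_def intro!: is_subring_power is_subringD(4))
    finally have "(y - of_int j) ^ k \<in> P" using k by simp
    then show ?thesis using rad yA jA A unfolding A_def by (blast intro: is_subringD(4))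
  qed
  have "(y - of_int j) - (x - of_int j) \<in> P"
    by (rule ideal_of_diff[OF A P(1)[folded A_def] yj xj])
  then have yx: "y - x \<in> P" by simp
  have "y ^ k - x ^ k \<in> P" for k
  proof (induction k)
    case 0
    then show ?case using ideal_ofD(3)[OF P(1)] by simp
  next
    case (Suc k)
    have "y ^ Suc k - x ^ Suc k = y * (y ^ k - x ^ k) + x ^ k * (y - x)"
      by (simp add: algebra_simps)
    also have "\<dots> \<in> P"
      using yA xA is_subring_power[OF A xA] Suc yx
      by (intro ideal_ofD(4)[OF P(1)] ideal_ofD(5)[OF P(1)]) (auto simp: A_def)
    finally show ?case .
  qed
  \<comment> \<open>As \<open>y \<noteq> x\<close> and \<open>y ^ N = x ^ N\<close>, the sum of the
    terms \<open>y ^ k * x ^ (N - Suc k)\<close> vanishes. Replacing \<open>y\<close> by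
    \<open>x\<close> modulo \<open>P\<close> turns it into \<open>of_nat N * x ^ (N - 1)\<close>,
    which thus lies in \<open>P\<close> and so in \<open>Q\<close>. Hence \<open>l\<close> divides
    \<open>int N * j ^ (N - 1)\<close>.\<close>
  then have "(\<Sum>k<N. (y ^ k - x ^ k) * x ^ (N - Suc k)) \<in> P"
    using is_subring_power[OF A xA] by (intro ideal_of_sum[OF P(1)] ideal_ofD(6)[OF P(1)]) (auto simp: A_def)
  moreover have "(\<Sum>k<N. (y ^ k - x ^ k) * x ^ (N - Suc k)) = - (of_nat N * x ^ (N - 1))"
  proof -
    have "(y - x) * (\<Sum>k<N. y ^ k * x ^ (N - Suc k)) = 0"
      using N(2) power_diff_sumr2[of y N x] by (simp add: mult.commute)
    then have 0: "(\<Sum>k<N. y ^ k * x ^ (N - Suc k)) = 0" using neq by simp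
    have "(\<Sum>k<N. x ^ k * x ^ (N - Suc k)) = (\<Sum>k<N. x ^ (N - 1))"
      by (intro sum.cong) (auto simp flip: power_add)
    then show ?thesis using 0 by (simp add: sum_subtractf left_diff_distrib)
  qed
  ultimately have "0 - - (of_nat N * x ^ (N - 1)) \<in> P"
    by (intro ideal_of_diff[OF A P(1)[folded A_def] ideal_ofD(3)[OF P(1)]]) simp
  moreover have N1: "of_nat N * x ^ (N - 1) = ev (monom (int N) (N - 1))"
    by (simp add: ev_def map_poly_monom poly_monom)
  ultimately have "ev (monom (int N) (N - 1)) \<in> Q" using P(3) by (auto simp: R_def)
  then have "l dvd int N * j ^ (N - 1)" unfolding Q_iff by (simp add: poly_monom)
  then have "l dvd int N \<or> l dvd j ^ (N - 1)" using l(1) by (simp only: prime_dvd_mult_iff)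
  then show False using l prime_dvd_power[of l j] by blast
qed

section \<open>Minimal polynomials over a subfield\<close>

lemma is_subfield_imp_subring: "is_subfield K \<Longrightarrow> is_subring K"
  by (auto simp: is_subfield_def is_subring_def)

lemma is_idealD:
  assumes "is_ideal I"
  shows "0 \<in> I" "x \<in> I \<Longrightarrow> y \<in> I \<Longrightarrow> x + y \<in> I" "x \<in> I \<Longrightarrow> a * x \<in> I" "x \<in> I \<Longrightarrow> x * a \<in> I"
    "x \<in> I \<Longrightarrow> - x \<in> I" "x \<in> I \<Longrightarrow> y \<in> I \<Longrightarrow> x - y \<in> I"
proof -
  show I: "0 \<in> I" "x \<in> I \<Longrightarrow> y \<in> I \<Longrightarrow> x + y \<in> I" "x \<in> I \<Longrightarrow> a * x \<in> I" "x \<in> I \<Longrightarrow> x * a \<in> I"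
    for x y a using assms by (auto simp: is_ideal_def mult.commute)
  show minus: "x \<in> I \<Longrightarrow> - x \<in> I" for x using I(3)[of x "- 1"] by simp
  show "x \<in> I \<Longrightarrow> y \<in> I \<Longrightarrow> x - y \<in> I" using I(2)[of x "- y"] minus[of y] by simp
qed

text \<open>Long division stays over \<open>K\<close>: the leading coefficient of the divisor has
  its inverse there, although the ambient ring is only a domain.\<close>

lemma polys_over_divmod:
  fixes f g :: "'a::idom poly"
  assumes K: "is_subfield K" and f: "f \<in> polys_over K" "f \<noteq> 0" and g: "g \<in> polys_over K"
  shows "\<exists>q\<in>polys_over K. \<exists>r\<in>polys_over K. g = f * q + r \<and> (r = 0 \<or> degree r < degree f)"
  using g
proof (induction "degree g" arbitrary: g rule: less_induct)
  case less
  have Ks: "is_subring K" by (rule is_subfield_imp_subring[OF K])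
  have Ps: "is_subring (polys_over K)" by (rule is_subring_polys_over[OF Ks])
  show ?case
  proof (cases "g = 0 \<or> degree g < degree f")
    case True
    then show ?thesis using less.prems is_subringD(1)[OF Ps]
      by (intro bexI[of _ 0] bexI[of _ g]) auto
  next
    case False
    have lK: "lead_coeff f \<in> K" "lead_coeff g \<in> K"
      using f less.prems by (auto simp: polys_over_def)
    then obtain b where b: "b \<in> K" "lead_coeff f * b = 1"
      using K f(2) unfolding is_subfield_def by (metis leading_coeff_0_iff)
    define m where "m = monom (b * lead_coeff g) (degree g - degree f)"
    have m: "m \<in> polys_over K" unfolding m_def
      by (intro polys_over_monom is_subringD[OF Ks] b lK)
    define h where "h = g - f * m"
    have hK: "h \<in> polys_over K" unfolding h_def
      by (intro is_subringD[OF Ps] less.prems f m)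
    have mc: "b * lead_coeff g \<noteq> 0" using b False by auto
    have "m \<noteq> 0" using mc by (simp add: m_def)
    moreover have dm: "degree m = degree g - degree f" unfolding m_def by (rule degree_monom_eq[OF mc])
    ultimately have dfm: "degree (f * m) = degree g"
      using False f(2) dm by (simp add: degree_mult_eq)
    have lfm: "lead_coeff (f * m) = lead_coeff g"
      using b(2) unfolding lead_coeff_mult m_def lead_coeff_monom
      by (simp add: mult.assoc[symmetric])
    have "h = 0 \<or> degree h < degree g"
    proof (cases "degree g = 0")
      case True
      then have "h = 0" using dfm lfm unfolding h_def
        by (metis degree_0_id eq_iff_diff_eq_0)
      then show ?thesis by simp
    next
      case d: False
      have "degree h \<le> degree g" unfolding h_def by (rule degree_diff_le) (auto simp: dfm)
      moreover have "coeff h (degree g) = 0" using lfm dfm by (simp add: h_def)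
      ultimately show ?thesis by (metis leading_coeff_0_iff le_neq_implies_less)
    qed
    then have "\<exists>q\<in>polys_over K. \<exists>r\<in>polys_over K. h = f * q + r \<and> (r = 0 \<or> degree r < degree f)"
    proof
      assume "h = 0"
      then show ?thesis using is_subringD(1)[OF Ps] by (intro bexI[of _ 0]) auto
    next
      assume "degree h < degree g"
      then show ?thesis using less.hyps hK by blast
    qed
    then obtain q r where qr: "q \<in> polys_over K" "r \<in> polys_over K" "h = f * q + r"
      "r = 0 \<or> degree r < degree f" by blast
    have "g = f * (q + m) + r" using qr(3) by (simp add: h_def algebra_simps)
    moreover have "q + m \<in> polys_over K" by (intro is_subringD[OF Ps] qr m)
    ultimately show ?thesis using qr by blast
  qed
qed

text \<open>The polynomials over \<open>K\<close> with value in \<open>I\<close> form an ideal of a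
  principal ideal domain. For \<open>I = {0}\<close> the generator is the minimal polynomial of
  \<open>x\<close>, and for a maximal ideal that of the residue class of \<open>x\<close>; both
  cases occur below.\<close>

lemma exists_minimal_poly_mod_ideal:
  fixes x :: "'a::idom"
  assumes K: "is_subfield K" and I: "is_ideal I" and g: "g \<in> polys_over K" "g \<noteq> 0" "poly g x \<in> I"
  obtains f where "f \<in> polys_over K" "lead_coeff f = 1" "poly f x \<in> I"
    "\<And>h. h \<in> polys_over K \<Longrightarrow> poly h x \<in> I \<Longrightarrow> \<exists>q\<in>polys_over K. h = f * q"
proof -
  have Ks: "is_subring K" by (rule is_subfield_imp_subring[OF K])
  have Ps: "is_subring (polys_over K)" by (rule is_subring_polys_over[OF Ks])
  define Z where "Z = (\<lambda>f. f \<in> polys_over K \<and> f \<noteq> 0 \<and> poly f x \<in> I)"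
  have "Z g" using g by (simp add: Z_def)
  then obtain f0 where f0: "Z f0" "\<And>h. Z h \<Longrightarrow> degree f0 \<le> degree h"
    using ex_has_least_nat[of Z _ degree] by blast
  have "lead_coeff f0 \<in> K" "lead_coeff f0 \<noteq> 0" using f0(1) by (auto simp: Z_def polys_over_def)
  then obtain b where b: "b \<in> K" "lead_coeff f0 * b = 1" using K by (auto simp: is_subfield_def)
  define f where "f = smult b f0"
  have b0: "b \<noteq> 0" using b(2) by auto
  have f: "Z f" "degree f = degree f0" "lead_coeff f = 1"
    using f0(1) b b0 by (auto simp: Z_def f_def polys_over_def mult.commute
        intro: is_subringD[OF Ks] is_idealD[OF I])
  show thesis
  proof (rule that[of f])
    show "f \<in> polys_over K" "poly f x \<in> I" using f(1) by (auto simp: Z_def)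
    show "lead_coeff f = 1" by (rule f(3))
    fix h assume h: "h \<in> polys_over K" "poly h x \<in> I"
    obtain q r where qr: "q \<in> polys_over K" "r \<in> polys_over K" "h = f * q + r"
      "r = 0 \<or> degree r < degree f"
      using polys_over_divmod[OF K _ _ h(1), of f] f(1) by (auto simp: Z_def)
    have "poly r x = poly h x - poly q x * poly f x" by (simp add: qr(3))
    also have "\<dots> \<in> I" using h f(1) by (intro is_idealD(6)[OF I] is_idealD(3)[OF I]) (auto simp: Z_def)
    finally have "r = 0" using qr f0(2)[of r] f(2) by (fastforce simp: Z_def)
    then show "\<exists>q\<in>polys_over K. h = f * q" using qr by auto
  qed
qed

text \<open>In characteristic zero the derivative of a nonconstant \<open>f\<close> is nonzero and
  of smaller degree, so it is no multiple of \<open>f\<close>; \<open>1 \<notin> I\<close> excludes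
  the constant \<open>f = 1\<close>.\<close>

lemma pderiv_minimal_poly_notin:
  fixes x :: "'a::idom"
  assumes char: "\<And>n::nat. n > 0 \<Longrightarrow> of_nat n \<noteq> (0::'a)"
    and K: "is_subfield K" and I: "1 \<notin> I" and f: "f \<in> polys_over K" "lead_coeff f = 1" "poly f x \<in> I"
    and min: "\<And>h. h \<in> polys_over K \<Longrightarrow> poly h x \<in> I \<Longrightarrow> \<exists>q\<in>polys_over K. h = f * q"
  shows "poly (pderiv f) x \<notin> I"
proof
  assume p: "poly (pderiv f) x \<in> I"
  have Ks: "is_subring K" by (rule is_subfield_imp_subring[OF K])
  have d: "degree f \<noteq> 0"
  proof
    assume "degree f = 0"
    then have "f = 1" using f(2) by (metis degree_0_id one_pCons)
    then show False using f(3) I by simp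
  qed
  have "pderiv f \<in> polys_over K"
    using f(1) by (auto simp: polys_over_def coeff_pderiv intro!: is_subringD[OF Ks] is_subring_of_nat[OF Ks]
        simp flip: of_nat_Suc)
  then obtain q where q: "pderiv f = f * q" using min p by blast
  have "coeff (pderiv f) (degree f - 1) = of_nat (degree f)"
    using d f(2) by (simp add: coeff_pderiv flip: of_nat_Suc)
  then have "pderiv f \<noteq> 0" using char[of "degree f"] d by auto
  then have "degree f \<le> degree (pderiv f)" unfolding q by (subst degree_mult_eq) auto
  moreover have "degree (pderiv f) \<le> degree f - 1"
    by (rule degree_le) (auto simp: coeff_pderiv coeff_eq_0)
  ultimately show False using d by linarith
qed

section \<open>Conjugates in the algebraic closure\<close>

lemma map_poly_to_ac_add: "map_poly to_ac (p + q) = map_poly to_ac p + map_poly to_ac q"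
  by (rule poly_eqI) (simp add: coeff_map_poly)

lemma map_poly_to_ac_mult: "map_poly to_ac (p * q) = map_poly to_ac p * map_poly to_ac q"
  by (rule poly_eqI) (simp add: coeff_map_poly coeff_mult to_ac_sum)

lemma map_poly_to_ac_power: "map_poly to_ac (p ^ n) = map_poly to_ac p ^ n"
  by (induction n) (simp_all add: map_poly_to_ac_mult)

lemma poly_map_poly_to_ac: "poly (map_poly to_ac p) (to_ac x) = to_ac (poly p x)"
  by (induction p) (simp_all add: map_poly_pCons)

text \<open>If \<open>y\<close> is another conjugate of \<open>x\<close> over \<open>K\<close> in the algebraic closure, then the translates of
  \<open>x\<close> and \<open>y\<close> by integers have common powers.\<close>

theorem in_subfield_if_translates_power_in_subfield:
  fixes x :: "'a::field"
  assumes char: "\<And>n::nat. n > 0 \<Longrightarrow> of_nat n \<noteq> (0::'a)"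
    and K: "is_subfield K" and pow: "\<And>i::int. \<exists>N>0. (x - of_int i) ^ N \<in> K"
  shows "x \<in> K"
proof -
  have Ks: "is_subring K" by (rule is_subfield_imp_subring[OF K])
  have Ps: "is_subring (polys_over K)" by (rule is_subring_polys_over[OF Ks])
  have I: "is_ideal {0::'a}" by (auto simp: is_ideal_def)
  have XK: "[:- of_int i, 1:] \<in> polys_over K" for i
    by (simp add: polys_over_0 is_subringD[OF Ks] is_subring_of_int[OF Ks])
  have CK: "[:c:] \<in> polys_over K" if "c \<in> K" for c
    using that by (simp add: polys_over_0 is_subringD[OF Ks])
  have G: "[:- of_int i, 1:] ^ N - [:c:] \<in> polys_over K" if "c \<in> K" for c i N
    by (intro is_subringD[OF Ps] is_subring_power[OF Ps] XK CK that)
  obtain N where N: "N > 0" "(x - of_int 0) ^ N \<in> K" using pow by blast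
  \<comment> \<open>The translate by zero shows that \<open>x\<close> is algebraic over
    \<open>K\<close>, so a minimal polynomial exists; \<open>of_int 0\<close> is kept to match
    \<open>G\<close>.\<close>
  define g where "g = [:- of_int 0, 1:] ^ N - [:(x - of_int 0) ^ N:]"
  have "coeff g N = 1"
    using N(1) coeff_linear_power[of "0::'a" N] by (cases N) (simp_all add: g_def)
  then have g: "g \<in> polys_over K" "g \<noteq> 0" "poly g x \<in> {0}"
    using G[OF N(2), of 0 N] by (auto simp: g_def)
  obtain f where f: "f \<in> polys_over K" "lead_coeff f = 1" "poly f x \<in> {0}"
    and min: "\<And>h. h \<in> polys_over K \<Longrightarrow> poly h x \<in> {0} \<Longrightarrow> \<exists>q\<in>polys_over K. h = f * q"
    using exists_minimal_poly_mod_ideal[OF K I g] by blast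
  have sep: "poly (pderiv f) x \<noteq> 0"
    using pderiv_minimal_poly_notin[OF char K _ f min] by simp
  have "[:- x, 1:] dvd f" using f(3) by (simp add: poly_eq_0_iff_dvd)
  then obtain h where h: "f = [:- x, 1:] * h" by (elim dvdE)
  have lh: "lead_coeff h = 1" using f(2) unfolding h by (simp only: lead_coeff_mult) simp
  show ?thesis
  proof (cases "degree h = 0")
    case True
    then have "h = 1" using lh by (metis degree_0_id one_pCons)
    then have "coeff f 0 = - x" by (simp add: h)
    then have "- x \<in> K" using f(1) by (metis mem_Collect_eq polys_over_def)
    then have "- (- x) \<in> K" by (rule is_subringD(6)[OF Ks])
    then show ?thesis by simp
  next
    case False
    then have "degree (map_poly to_ac h) > 0" by (subst degree_map_poly) auto
    \<comment> \<open>A root of the cofactor of \<open>[:- x, 1:]\<close> in the minimal polynomial,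
      thus a conjugate of \<open>x\<close>. It is shown to equal \<open>x\<close>, which
      separability forbids.\<close>
    then obtain y where y: "poly (map_poly to_ac h) y = 0"
      using alg_closed_imp_poly_has_root by blast
    have "y = to_ac x"
    proof (rule eq_if_all_translates_power_eq)
      show "of_nat n \<noteq> (0 :: 'a alg_closure)" if "n > 0" for n
        using char[OF that] by (metis to_ac_eq_0_iff to_ac_of_nat)
      fix i :: int
      obtain N where N: "N > 0" "(x - of_int i) ^ N \<in> K" using pow by blast
      \<comment> \<open>This polynomial over \<open>K\<close> vanishes at \<open>x\<close>, so it is
        a multiple of \<open>f\<close> and vanishes at \<open>y\<close> as well; the vanishing at
        \<open>y\<close> is the equality of the two powers.\<close>
      have "\<exists>q\<in>polys_over K. [:- of_int i, 1:] ^ N - [:(x - of_int i) ^ N:] = f * q"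
        by (rule min[OF G[OF N(2)]]) simp
      then obtain q where "[:- of_int i, 1:] ^ N = f * q + [:(x - of_int i) ^ N:]"
        by (metis diff_add_cancel)
      then have "map_poly to_ac ([:- of_int i, 1:] ^ N) = map_poly to_ac ([:- x, 1:] * h * q + [:(x - of_int i) ^ N:])"
        by (simp only: h)
      then have "poly (map_poly to_ac [:- of_int i, 1:] ^ N) y =
          poly (map_poly to_ac [:- x, 1:] * map_poly to_ac h * map_poly to_ac q
            + map_poly to_ac [:(x - of_int i) ^ N:]) y"
        by (simp only: map_poly_to_ac_add map_poly_to_ac_mult map_poly_to_ac_power)
      then have "(y - of_int i) ^ N = (to_ac x - of_int i) ^ N"
        by (simp add: map_poly_pCons y)
      then show "\<exists>N>0. (y - of_int i) ^ N = (to_ac x - of_int i) ^ N" using N(1) by blast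
    qed
    then have "to_ac (poly h x) = 0" using y
      by (simp flip: poly_map_poly_to_ac)
    \<comment> \<open>Both factors of \<open>f\<close> vanish at \<open>x\<close>, which makes
      \<open>x\<close> a double root, against \<open>sep\<close>.\<close>
    then have "poly (pderiv f) x = 0" unfolding h pderiv_mult by (simp add: pderiv_pCons)
    then show ?thesis using sep by simp
  qed
qed

section \<open>Complete local domains and Hensel's lemma\<close>

lemma is_ideal_ideal_gen: "is_ideal (ideal_gen A)"
  by (auto simp: ideal_gen_def is_ideal_def)

lemma ideal_gen_superset: "A \<subseteq> ideal_gen A"
  by (auto simp: ideal_gen_def)

lemma ideal_gen_least: "is_ideal I \<Longrightarrow> A \<subseteq> I \<Longrightarrow> ideal_gen A \<subseteq> I"
  by (auto simp: ideal_gen_def)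

lemma is_ideal_multiples: "is_ideal {x. a dvd x}"
  by (auto simp: is_ideal_def)

lemma ideal_gen_singleton: "ideal_gen {a} = {x. a dvd x}"
proof
  show "ideal_gen {a} \<subseteq> {x. a dvd x}" by (rule ideal_gen_least[OF is_ideal_multiples]) auto
  show "{x. a dvd x} \<subseteq> ideal_gen {a}"
    using ideal_gen_superset[of "{a}"] is_idealD(4)[OF is_ideal_ideal_gen] by (auto elim!: dvdE)
qed

lemma is_ideal_ideal_pow: "is_ideal (ideal_pow M n)"
  unfolding ideal_pow_def by (rule is_ideal_ideal_gen)

lemma prod_list_in_ideal_pow: "set xs \<subseteq> M \<Longrightarrow> prod_list xs \<in> ideal_pow M (length xs)"
  unfolding ideal_pow_def by (rule subsetD[OF ideal_gen_superset]) blast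

lemma ideal_pow_mult:
  assumes "a \<in> ideal_pow M k" "b \<in> ideal_pow M l"
  shows "a * b \<in> ideal_pow M (k + l)"
proof -
  note I = is_ideal_ideal_pow[of M "k + l"]
  have "prod_list xs * b \<in> ideal_pow M (k + l)" if xs: "length xs = k" "set xs \<subseteq> M" for xs
  proof -
    \<comment> \<open>As \<open>ideal_gen\<close> is an intersection, a property passes from the
      generators to the whole ideal once its instances form an ideal. This is applied to the right
      factor first, then to the left.\<close>
    have "is_ideal {b. prod_list xs * b \<in> ideal_pow M (k + l)}"
      unfolding is_ideal_def using is_idealD[OF I]
      by (auto simp: distrib_left mult.left_commute)
    then have "ideal_pow M l \<subseteq> {b. prod_list xs * b \<in> ideal_pow M (k + l)}"
      unfolding ideal_pow_def[of M l]
    proof (rule ideal_gen_least, safe)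
      fix ys assume ys: "l = length ys" "set ys \<subseteq> M"
      then show "prod_list xs * prod_list ys \<in> ideal_pow M (k + length ys)"
        using prod_list_in_ideal_pow[of "xs @ ys" M] xs by simp
    qed
    then show ?thesis using assms(2) by blast
  qed
  moreover have "is_ideal {a. a * b \<in> ideal_pow M (k + l)}"
    unfolding is_ideal_def using is_idealD[OF I]
    by (auto simp: distrib_right mult.assoc)
  ultimately have "ideal_pow M k \<subseteq> {a. a * b \<in> ideal_pow M (k + l)}"
    unfolding ideal_pow_def[of M k] by (intro ideal_gen_least) auto
  then show ?thesis using assms(1) by blast
qed

lemma ideal_pow_antimono:
  assumes "k \<le> l" shows "ideal_pow M l \<subseteq> ideal_pow M k"
  unfolding ideal_pow_def[of M l]
proof (rule ideal_gen_least[OF is_ideal_ideal_pow], safe)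
  fix xs assume xs: "l = length xs" "set xs \<subseteq> M"
  have "prod_list (take k xs) \<in> ideal_pow M k"
    using prod_list_in_ideal_pow[of "take k xs" M] assms xs set_take_subset[of k xs] by auto
  then have "prod_list (take k xs) * prod_list (drop k xs) \<in> ideal_pow M k"
    by (rule is_idealD(4)[OF is_ideal_ideal_pow])
  then show "prod_list xs \<in> ideal_pow M k" by (metis append_take_drop_id prod_list.append)
qed

lemma ideal_pow_Suc_0:
  assumes "is_ideal M" shows "ideal_pow M (Suc 0) = M"
proof
  show "ideal_pow M (Suc 0) \<subseteq> M"
    unfolding ideal_pow_def using assms by (intro ideal_gen_least) (auto simp: length_Suc_conv)
  show "M \<subseteq> ideal_pow M (Suc 0)"
    using prod_list_in_ideal_pow[of "[x]" M for x] by auto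
qed

lemma exists_maximal_ideal_containing:
  assumes "\<not> x dvd (1::'a::comm_ring_1)"
  shows "\<exists>N. is_maximal_ideal N \<and> x \<in> N"
proof -
  define C where "C = {J. is_ideal J \<and> x \<in> J \<and> 1 \<notin> J}"
  have "{y. x dvd y} \<in> C" using assms is_ideal_multiples[of x] by (simp add: C_def)
  then have ne: "C \<noteq> {}" by blast
  have "\<exists>N\<in>C. \<forall>J\<in>C. N \<subseteq> J \<longrightarrow> J = N"
  proof (rule subset_Zorn_nonempty[OF ne])
    fix S assume S: "S \<noteq> {}" "subset.chain C S"
    have "is_ideal (\<Union>S)"
      unfolding is_ideal_def
    proof (intro conjI ballI allI)
      show "0 \<in> \<Union>S" using S by (auto simp: subset_chain_def C_def is_ideal_def)
      fix u v assume "u \<in> \<Union>S" "v \<in> \<Union>S"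
      then obtain I J where IJ: "I \<in> S" "J \<in> S" "u \<in> I" "v \<in> J" by blast
      then have "I \<subseteq> J \<or> J \<subseteq> I" using S(2) by (auto simp: subset_chain_def)
      then obtain H where H: "H \<in> S" "u \<in> H" "v \<in> H" using IJ by blast
      then have "is_ideal H" using S(2) by (auto simp: subset_chain_def C_def)
      then show "u + v \<in> \<Union>S" using H is_idealD(2) by blast
    next
      fix a u assume "u \<in> \<Union>S"
      then obtain H where H: "H \<in> S" "u \<in> H" by blast
      then have "is_ideal H" using S(2) by (auto simp: subset_chain_def C_def)
      then show "a * u \<in> \<Union>S" using H is_idealD(3) by blast
    qed
    then show "\<Union>S \<in> C" using S by (auto simp: C_def subset_chain_def)
  qed
  then obtain N where N: "N \<in> C" "\<And>J. J \<in> C \<Longrightarrow> N \<subseteq> J \<Longrightarrow> J = N" by blast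
  have "J = N" if J: "is_ideal J" "N \<subseteq> J" "J \<noteq> UNIV" for J
  proof -
    have "1 \<notin> J" using J is_idealD(3)[OF J(1), of 1] by auto
    then show ?thesis using J N by (auto simp: C_def)
  qed
  then have "is_maximal_ideal N" using N(1) unfolding is_maximal_ideal_def C_def by blast
  then show ?thesis using N(1) by (auto simp: C_def)
qed

lemma poly_add_eq_poly_plus_mult: "\<exists>q. poly p (d + h) = poly p d + h * q"
  for d h :: "'a::comm_ring_1"
proof (induction p)
  case (pCons a p)
  then obtain q where "poly p (d + h) = poly p d + h * q" by blast
  then have "poly (pCons a p) (d + h) = poly (pCons a p) d + h * (poly p d + d * q + h * q)"
    by (simp add: algebra_simps)
  then show ?case by blast
qed (auto intro: exI[of _ 0])

lemma poly_taylor_two: "\<exists>q. poly p (d + h) = poly p d + h * poly (pderiv p) d + h * h * q"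
  for d h :: "'a::idom"
proof (induction p)
  case (pCons a p)
  then obtain q where q: "poly p (d + h) = poly p d + h * poly (pderiv p) d + h * h * q" by blast
  have "poly (pCons a p) (d + h) = poly (pCons a p) d + h * poly (pderiv (pCons a p)) d
      + h * h * (poly (pderiv p) d + d * q + h * q)"
    by (simp add: q pderiv_pCons algebra_simps)
  then show ?case by blast
qed (auto intro: exI[of _ 0])

section \<open>Units, limits and Hensel's lemma\<close>

locale complete_local_domain =
  fixes M :: "'a::idom set"
  assumes complete_local: "complete_local_ring M"
    and residue_char: "residue_char_zero M"
begin

lemma maximal: "is_maximal_ideal M"
  using complete_local by (simp add: complete_local_ring_def local_ring_with_max_def)

lemma M_ideal: "is_ideal M"
  using maximal by (simp add: is_maximal_ideal_def)

lemma one_notin_M: "1 \<notin> M"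
  using maximal is_idealD(3)[OF M_ideal, of 1] by (auto simp: is_maximal_ideal_def)

lemma unit_iff: "x dvd 1 \<longleftrightarrow> x \<notin> M"
proof
  show "x dvd 1 \<Longrightarrow> x \<notin> M"
    using one_notin_M is_idealD(4)[OF M_ideal] by (metis dvdE)
  show "x \<notin> M \<Longrightarrow> x dvd 1"
    using exists_maximal_ideal_containing complete_local
    by (auto simp: complete_local_ring_def local_ring_with_max_def)
qed

lemma unit_inverse:
  assumes "x \<notin> M" obtains y where "x * y = 1" "y \<notin> M"
proof -
  obtain y where y: "x * y = 1" using assms unit_iff by (metis dvdE)
  then have "y dvd 1" by (metis dvd_triv_right)
  with y that unit_iff show thesis by blast
qed

lemma M_prime: "x * y \<in> M \<longleftrightarrow> x \<in> M \<or> y \<in> M"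
proof
  assume xy: "x * y \<in> M"
  show "x \<in> M \<or> y \<in> M"
  proof (rule ccontr)
    assume "\<not> (x \<in> M \<or> y \<in> M)"
    then obtain a b where "x * a = 1" "y * b = 1" using unit_inverse by meson
    then have "(x * y) * (a * b) = 1" by (metis mult.assoc mult.commute mult_1)
    then show False using is_idealD(4)[OF M_ideal xy, of "a * b"] one_notin_M by simp
  qed
qed (use is_idealD[OF M_ideal] in blast)

lemma of_nat_notin_M: "n > 0 \<Longrightarrow> of_nat n \<notin> M"
  using residue_char by (auto simp: residue_char_zero_def)

lemma notin_M_add: "x \<notin> M \<Longrightarrow> y - x \<in> M \<Longrightarrow> y \<notin> M"
  using is_idealD(6)[OF M_ideal, of y "y - x"] by auto

lemma ideal_pow_Int_eq: "(\<And>k. x \<in> ideal_pow M k) \<Longrightarrow> x = 0"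
  using complete_local by (auto simp: complete_local_ring_def madic_complete_def)

text \<open>The differences from index \<open>n\<close> on all lie in the additive group
  \<open>ideal_pow M n\<close>, so the error bound holds at \<open>n\<close> itself and not only
  eventually.\<close>

lemma madic_limit:
  assumes step: "\<And>n. s (Suc n) - s n \<in> ideal_pow M n"
  obtains L where "\<And>n. s n - L \<in> ideal_pow M n"
proof -
  have diff: "s (n + j) - s n \<in> ideal_pow M n" for n j
  proof (induction j)
    case (Suc j)
    have "s (Suc (n + j)) - s (n + j) \<in> ideal_pow M n"
      using step[of "n + j"] ideal_pow_antimono[of n "n + j" M] by auto
    from is_idealD(2)[OF is_ideal_ideal_pow this Suc] show ?case by simp
  qed (simp add: is_idealD(1)[OF is_ideal_ideal_pow])
  have "\<forall>k. \<exists>N. \<forall>m\<ge>N. \<forall>n\<ge>N. s m - s n \<in> ideal_pow M k"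
  proof (intro allI exI impI)
    fix k m n :: nat assume mn: "m \<ge> k" "n \<ge> k"
    have "s m - s k \<in> ideal_pow M k" "s n - s k \<in> ideal_pow M k"
      using diff[of k "m - k"] diff[of k "n - k"] mn by simp_all
    from is_idealD(6)[OF is_ideal_ideal_pow this] show "s m - s n \<in> ideal_pow M k" by simp
  qed
  then obtain L where L: "\<And>k. \<exists>N. \<forall>n\<ge>N. s n - L \<in> ideal_pow M k"
    using complete_local unfolding complete_local_ring_def madic_complete_def by blast
  show thesis
  proof (rule that)
    fix k
    obtain N where N: "\<And>n. n \<ge> N \<Longrightarrow> s n - L \<in> ideal_pow M k" using L by blast
    have "s (k + N) - L \<in> ideal_pow M k" by (rule N) simp
    from is_idealD(6)[OF is_ideal_ideal_pow this diff[of k N]] show "s k - L \<in> ideal_pow M k" by simp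
  qed
qed

text \<open>Newton iteration with the slope frozen at \<open>d\<close>: using the fixed inverse
  \<open>u\<close> of \<open>poly (pderiv f) d\<close>, each step gains one power of
  \<open>M\<close>, which is enough for convergence.\<close>

theorem hensel:
  assumes f: "poly f d \<in> M" and f': "poly (pderiv f) d \<notin> M"
  obtains e where "poly f e = 0" "e - d \<in> M"
proof -
  obtain u where u: "poly (pderiv f) d * u = 1" using unit_inverse[OF f'] by blast
  define s where "s = rec_nat d (\<lambda>_ x. x - u * poly f x)"
  have s0: "s 0 = d" and sS: "s (Suc n) = s n - u * poly f (s n)" for n by (simp_all add: s_def)
  have inv: "poly f (s n) \<in> ideal_pow M (Suc n) \<and> s n - d \<in> M" for n
  proof (induction n)
    case 0
    then show ?case using f is_idealD(1)[OF M_ideal] by (simp add: s0 ideal_pow_Suc_0[OF M_ideal])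
  next
    case (Suc n)
    define h where "h = - (u * poly f (s n))"
    have h: "h \<in> ideal_pow M (Suc n)" unfolding h_def
      using Suc by (intro is_idealD(5)[OF is_ideal_ideal_pow] is_idealD(3)[OF is_ideal_ideal_pow]) auto
    then have hM: "h \<in> M"
      using ideal_pow_antimono[of "Suc 0" "Suc n" M] ideal_pow_Suc_0[OF M_ideal] by auto
    have sh: "s (Suc n) = s n + h" by (simp add: sS h_def)
    obtain q where q: "poly f (s n + h) = poly f (s n) + h * poly (pderiv f) (s n) + h * h * q"
      using poly_taylor_two by blast
    obtain r where "poly (pderiv f) (d + (s n - d)) = poly (pderiv f) d + (s n - d) * r"
      using poly_add_eq_poly_plus_mult by blast
    then have f'n: "poly (pderiv f) (s n) = poly (pderiv f) d + (s n - d) * r" by simp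
    have "1 - u * poly (pderiv f) (s n) = - (u * ((s n - d) * r))"
      unfolding f'n using u by (simp add: distrib_left mult.commute)
    also have "\<dots> \<in> M" by (intro is_idealD(5)[OF M_ideal] is_idealD(3)[OF M_ideal] is_idealD(4)[OF M_ideal]) (simp add: Suc)
    finally have "1 - u * poly (pderiv f) (s n) \<in> ideal_pow M (Suc 0)"
      by (simp add: ideal_pow_Suc_0[OF M_ideal])
    with Suc have 1: "poly f (s n) * (1 - u * poly (pderiv f) (s n)) \<in> ideal_pow M (Suc n + Suc 0)"
      by (intro ideal_pow_mult) auto
    have "h * h \<in> ideal_pow M (Suc n + Suc n)" by (intro ideal_pow_mult h)
    then have "h * h \<in> ideal_pow M (Suc n + Suc 0)"
      using ideal_pow_antimono[of "Suc n + Suc 0" "Suc n + Suc n" M] by auto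
    then have 2: "h * h * q \<in> ideal_pow M (Suc n + Suc 0)"
      by (rule is_idealD(4)[OF is_ideal_ideal_pow])
    \<comment> \<open>The Taylor expansion at \<open>s n\<close> with increment
      \<open>h = - (u * poly f (s n))\<close>. The first summand is \<open>poly f (s n)\<close>
      times an element of \<open>M\<close>, and the second contains \<open>h * h\<close>, so each
      gains a power of \<open>M\<close>.\<close>
    have "poly f (s (Suc n)) = poly f (s n) * (1 - u * poly (pderiv f) (s n)) + h * h * q"
      unfolding sh q by (simp add: h_def algebra_simps)
    also have "\<dots> \<in> ideal_pow M (Suc n + Suc 0)" by (rule is_idealD(2)[OF is_ideal_ideal_pow 1 2])
    finally have "poly f (s (Suc n)) \<in> ideal_pow M (Suc (Suc n))" by simp
    moreover have "(s n - d) + h \<in> M" using Suc hM by (intro is_idealD(2)[OF M_ideal]) auto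
    ultimately show ?case by (simp add: sh algebra_simps)
  qed
  have "s (Suc n) - s n \<in> ideal_pow M n" for n
  proof -
    have "- (u * poly f (s n)) \<in> ideal_pow M (Suc n)"
      using inv by (intro is_idealD(5)[OF is_ideal_ideal_pow] is_idealD(3)[OF is_ideal_ideal_pow]) auto
    then show ?thesis using ideal_pow_antimono[of n "Suc n" M] by (auto simp: sS)
  qed
  then obtain L where L: "\<And>n. s n - L \<in> ideal_pow M n" using madic_limit by blast
  have "poly f L = 0"
  proof (rule ideal_pow_Int_eq)
    fix k
    obtain r where "poly f (s k + (L - s k)) = poly f (s k) + (L - s k) * r"
      using poly_add_eq_poly_plus_mult by blast
    then have "poly f L = poly f (s k) - (s k - L) * r" by (simp add: algebra_simps)
    also have "\<dots> \<in> ideal_pow M k"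
      using inv[of k] ideal_pow_antimono[of k "Suc k" M]
      by (intro is_idealD(6)[OF is_ideal_ideal_pow _ is_idealD(4)[OF is_ideal_ideal_pow L[of k]]]) auto
    finally show "poly f L \<in> ideal_pow M k" .
  qed
  moreover have "L - d \<in> M"
    using is_idealD(6)[OF M_ideal conjunct2[OF inv[of 1]], of "s 1 - L"] L[of 1]
    by (simp add: ideal_pow_Suc_0[OF M_ideal])
  ultimately show thesis by (rule that)
qed

text \<open>Hensel's lemma for \<open>monom 1 n - [:a:]\<close> at \<open>1\<close>: the derivative
  there is \<open>of_nat n\<close>, a unit in residue characteristic zero.\<close>

lemma nth_root_near_1:
  assumes "a - 1 \<in> M" "n > 0"
  obtains u where "u ^ n = a" "u - 1 \<in> M"
proof -
  define f where "f = monom 1 n - [:a:]"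
  have "poly f 1 = - (a - 1)" by (simp add: f_def poly_monom)
  then have "poly f 1 \<in> M" using assms(1) is_idealD(5)[OF M_ideal] by metis
  moreover have "poly (pderiv f) 1 = of_nat n" by (simp add: f_def pderiv_diff pderiv_monom poly_monom)
  then have "poly (pderiv f) 1 \<notin> M" using of_nat_notin_M[OF assms(2)] by simp
  ultimately obtain e where "poly f e = 0" "e - 1 \<in> M" using hensel by blast
  then show thesis by (intro that[of e]) (auto simp: f_def poly_monom)
qed

section \<open>Coefficient fields\<close>

lemma subfield_Int_M:
  assumes "is_subfield K" "x \<in> K" "x \<in> M" shows "x = 0"
  using assms unit_iff[of x] unfolding is_subfield_def by (metis dvd_triv_left)

text \<open>Positive integers lie outside \<open>M\<close> and are units, so the domain contains a
  copy of the rationals; this starts the search for a maximal subfield.\<close>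

lemma exists_subfield: "\<exists>K::'a set. is_subfield K"
proof -
  define K where "K = {x::'a. \<exists>n>0. \<exists>m. of_nat n * x = of_int m}"
  have "is_subfield K"
    unfolding is_subfield_def
  proof (intro conjI ballI impI)
    show "0 \<in> K" unfolding K_def by (auto intro!: exI[of _ "1::nat"] exI[of _ "0::int"])
    show "1 \<in> K" unfolding K_def by (auto intro!: exI[of _ "1::nat"] exI[of _ "1::int"])
    fix x y assume "x \<in> K" "y \<in> K"
    then obtain m n k l where xy: "n > 0" "of_nat n * x = of_int m" "k > 0" "of_nat k * y = of_int l"
      by (auto simp: K_def)
    have "of_nat (n * k) * (x + y) = of_nat k * (of_nat n * x) + of_nat n * (of_nat k * y)"
      by (simp add: algebra_simps)
    also have "\<dots> = of_int (int k * m + int n * l)" by (simp add: xy)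
    finally show "x + y \<in> K" using xy unfolding K_def by (blast intro: mult_pos_pos)
    have "of_nat (n * k) * (x - y) = of_nat k * (of_nat n * x) - of_nat n * (of_nat k * y)"
      by (simp add: algebra_simps)
    also have "\<dots> = of_int (int k * m - int n * l)" by (simp add: xy)
    finally show "x - y \<in> K" using xy unfolding K_def by (blast intro: mult_pos_pos)
    have "of_nat (n * k) * (x * y) = (of_nat n * x) * (of_nat k * y)"
      by (simp add: algebra_simps)
    also have "\<dots> = of_int (m * l)" by (simp add: xy)
    finally show "x * y \<in> K" using xy unfolding K_def by (blast intro: mult_pos_pos)
  next
    fix x assume "x \<in> K" and x0: "x \<noteq> 0"
    then obtain m n where x: "n > 0" "of_nat n * x = of_int m" by (auto simp: K_def)
    have n: "of_nat n \<notin> M" by (rule of_nat_notin_M[OF x(1)])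
    have "of_nat n \<noteq> (0::'a)" using n is_idealD(1)[OF M_ideal] by metis
    then have "m \<noteq> 0" using x x0 by auto
    have "sgn m * m = \<bar>m\<bar>" by (metis abs_sgn mult.commute)
    \<comment> \<open>\<open>e\<close> is the sign of \<open>m\<close>. The inverse of
      \<open>m / n\<close> is written \<open>e * n / \<bar>m\<bar>\<close> to have a positive
      natural number as denominator.\<close>
    then obtain e where e: "e * m = int (nat \<bar>m\<bar>)" by auto
    define y' :: 'a where "y' = of_int (e * int n)"
    have m: "of_nat (nat \<bar>m\<bar>) \<notin> M" by (rule of_nat_notin_M) (use \<open>m \<noteq> 0\<close> in auto)
    obtain w :: 'a where w: "of_nat (nat \<bar>m\<bar>) * w = 1" using unit_inverse[OF m] by blast
    have "x * (y' * w) = of_int e * (of_nat n * x) * w"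
      unfolding y'_def of_int_mult of_int_of_nat_eq by (simp only: mult_ac)
    also have "\<dots> = of_int (e * m) * w" by (simp only: x(2) of_int_mult)
    also have "\<dots> = 1" using w by (simp only: e of_int_of_nat_eq)
    finally have "x * (y' * w) = 1" .
    moreover have "of_nat (nat \<bar>m\<bar>) * (y' * w) = y' * (of_nat (nat \<bar>m\<bar>) * w)"
      by (simp only: mult_ac)
    then have "of_nat (nat \<bar>m\<bar>) * (y' * w) = of_int (e * int n)" by (simp only: w y'_def mult_1_right)
    then have "y' * w \<in> K" using \<open>m \<noteq> 0\<close> unfolding K_def
      by (intro CollectI exI[of _ "nat \<bar>m\<bar>"] conjI exI[of _ "e * int n"]) auto
    ultimately show "\<exists>y\<in>K. x * y = 1" by blast
  qed
  then show ?thesis by blast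
qed

text \<open>A maximal subfield \<open>K\<close> works. Each residue class has a representative
  \<open>e\<close> such that all nonzero polynomial values at \<open>e\<close> over \<open>K\<close>
  are units; their quotients form a subfield \<open>K(e)\<close> of the domain, and maximality puts
  \<open>e\<close> into \<open>K\<close>.\<close>

theorem exists_coefficient_field: "\<exists>K. coefficient_field M K"
proof -
  define C where "C = {K::'a set. is_subfield K}"
  have ne: "C \<noteq> {}" using exists_subfield by (auto simp: C_def)
  have "\<exists>K\<in>C. \<forall>J\<in>C. K \<subseteq> J \<longrightarrow> J = K"
  proof (rule subset_Zorn_nonempty[OF ne])
    fix S assume S: "S \<noteq> {}" "subset.chain C S"
    have SC: "H \<in> S \<Longrightarrow> is_subfield H" for H using S(2) by (auto simp: subset_chain_def C_def)
    have pair: "\<exists>H\<in>S. u \<in> H \<and> v \<in> H" if uv: "u \<in> \<Union>S" "v \<in> \<Union>S" for u v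
    proof -
      obtain I J where IJ: "I \<in> S" "J \<in> S" "u \<in> I" "v \<in> J" using uv by blast
      then have "I \<subseteq> J \<or> J \<subseteq> I" using S(2) by (auto simp: subset_chain_def)
      then show ?thesis using IJ by blast
    qed
    have "is_subfield (\<Union>S)"
      unfolding is_subfield_def
    proof (intro conjI ballI impI)
      show "0 \<in> \<Union>S" "1 \<in> \<Union>S" using S(1) SC by (auto simp: is_subfield_def)
      fix u v assume "u \<in> \<Union>S" "v \<in> \<Union>S"
      then obtain H where "H \<in> S" "u \<in> H" "v \<in> H" using pair by blast
      then show "u + v \<in> \<Union>S" "u - v \<in> \<Union>S" "u * v \<in> \<Union>S"
        using SC[of H] unfolding is_subfield_def by blast+
    next
      fix u assume "u \<in> \<Union>S" "u \<noteq> 0"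
      then obtain H where "H \<in> S" "u \<in> H" by blast
      then show "\<exists>y\<in>\<Union>S. u * y = 1" using SC[of H] \<open>u \<noteq> 0\<close> unfolding is_subfield_def by blast
    qed
    then show "\<Union>S \<in> C" by (simp add: C_def)
  qed
  then obtain K where "K \<in> C" "\<forall>J\<in>C. K \<subseteq> J \<longrightarrow> J = K" by blast
  then have K: "is_subfield K" "\<And>J. is_subfield J \<Longrightarrow> K \<subseteq> J \<Longrightarrow> J = K" by (simp_all add: C_def)
  have Ks: "is_subring K" by (rule is_subfield_imp_subring[OF K(1)])
  have Ps: "is_subring (polys_over K)" by (rule is_subring_polys_over[OF Ks])
  have char: "of_nat n \<noteq> (0::'a)" if "n > 0" for n
    using of_nat_notin_M[OF that] is_idealD(1)[OF M_ideal] by metis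
  have ex: "\<exists>k\<in>K. d - k \<in> M" for d
  proof -
    \<comment> \<open>If the residue of \<open>d\<close> is transcendental over \<open>K\<close>,
      then \<open>e = d\<close> will do. Otherwise Hensel's lemma lifts it to a root of its own
      minimal polynomial, which divides every polynomial over \<open>K\<close> with value in
      \<open>M\<close>.\<close>
    have "\<exists>e. e - d \<in> M \<and> (\<forall>g\<in>polys_over K. poly g e \<in> M \<longrightarrow> poly g e = 0)"
    proof (cases "\<exists>g\<in>polys_over K. g \<noteq> 0 \<and> poly g d \<in> M")
      case False
      then show ?thesis using is_idealD(1)[OF M_ideal] by (intro exI[of _ d]) auto
    next
      case True
      then obtain f where f: "f \<in> polys_over K" "lead_coeff f = 1" "poly f d \<in> M"
        and min: "\<And>h. h \<in> polys_over K \<Longrightarrow> poly h d \<in> M \<Longrightarrow> \<exists>q\<in>polys_over K. h = f * q"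
        using exists_minimal_poly_mod_ideal[OF K(1) M_ideal] by blast
      have "poly (pderiv f) d \<notin> M"
        by (rule pderiv_minimal_poly_notin[OF char K(1) one_notin_M f min])
      then obtain e where e: "poly f e = 0" "e - d \<in> M" using hensel f(3) by blast
      have "poly g e = 0" if g: "g \<in> polys_over K" "poly g e \<in> M" for g
      proof -
        obtain r where "poly g (d + (e - d)) = poly g d + (e - d) * r"
          using poly_add_eq_poly_plus_mult by blast
        then have "poly g d = poly g e - (e - d) * r" by simp
        also have "\<dots> \<in> M" by (rule is_idealD(6)[OF M_ideal g(2) is_idealD(4)[OF M_ideal e(2)]])
        finally obtain q where "g = f * q" using min g(1) by blast
        then show ?thesis using e(1) by simp
      qed
      then show ?thesis using e by blast
    qed
    then obtain e where e: "e - d \<in> M" and e0: "\<And>g. g \<in> polys_over K \<Longrightarrow> poly g e \<in> M \<Longrightarrow> poly g e = 0"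
      by blast
    \<comment> \<open>This is \<open>K(e)\<close>, with quotients expressed by multiplication; a
      denominator outside \<open>M\<close> is a unit of the domain.\<close>
    define J where "J = {z. \<exists>g\<in>polys_over K. \<exists>h\<in>polys_over K. poly h e \<notin> M \<and> z * poly h e = poly g e}"
    have JI: "z \<in> J" if "g \<in> polys_over K" "h \<in> polys_over K" "poly h e \<notin> M" "z * poly h e = poly g e" for z g h
      using that by (auto simp: J_def)
    have "is_subfield J"
      unfolding is_subfield_def
    proof (intro conjI ballI impI)
      show "0 \<in> J" using JI[of 0 1 0] is_subringD[OF Ps] one_notin_M by simp
      show "1 \<in> J" using JI[of 1 1 1] is_subringD[OF Ps] one_notin_M by simp
      fix x y assume "x \<in> J" "y \<in> J"
      then obtain g h g' h' where xy: "g \<in> polys_over K" "h \<in> polys_over K" "poly h e \<notin> M" "x * poly h e = poly g e"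
        "g' \<in> polys_over K" "h' \<in> polys_over K" "poly h' e \<notin> M" "y * poly h' e = poly g' e"
        by (auto simp: J_def)
      have hh: "h * h' \<in> polys_over K" "poly (h * h') e \<notin> M" using xy is_subringD[OF Ps] by (auto simp: M_prime)
      show "x + y \<in> J"
      proof (rule JI[OF _ hh])
        show "g * h' + g' * h \<in> polys_over K" using xy by (intro is_subringD[OF Ps])
        show "(x + y) * poly (h * h') e = poly (g * h' + g' * h) e"
          by (simp add: algebra_simps flip: xy(4,8))
      qed
      show "x - y \<in> J"
      proof (rule JI[OF _ hh])
        show "g * h' - g' * h \<in> polys_over K" using xy by (intro is_subringD[OF Ps])
        show "(x - y) * poly (h * h') e = poly (g * h' - g' * h) e"
          by (simp add: algebra_simps flip: xy(4,8))
      qed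
      show "x * y \<in> J"
      proof (rule JI[OF _ hh])
        show "g * g' \<in> polys_over K" using xy by (intro is_subringD[OF Ps])
        show "(x * y) * poly (h * h') e = poly (g * g') e"
          by (simp add: algebra_simps flip: xy(4,8))
      qed
    next
      fix x assume "x \<in> J" and x0: "x \<noteq> 0"
      then obtain g h where x: "g \<in> polys_over K" "h \<in> polys_over K" "poly h e \<notin> M" "x * poly h e = poly g e"
        by (auto simp: J_def)
      have "poly h e \<noteq> 0" using x(3) is_idealD(1)[OF M_ideal] by auto
      then have "poly g e \<noteq> 0" using x0 by (simp flip: x(4))
      then have gM: "poly g e \<notin> M" using e0 x(1) by blast
      then obtain w where w: "poly g e * w = 1" using unit_inverse by blast
      have "poly h e * w \<in> J"
        by (rule JI[OF x(2) x(1) gM]) (use w in \<open>simp add: mult.assoc mult.commute[of w]\<close>)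
      moreover have "x * (poly h e * w) = 1" using w by (simp add: x(4) flip: mult.assoc)
      ultimately show "\<exists>y\<in>J. x * y = 1" by blast
    qed
    moreover have "K \<subseteq> J"
    proof
      fix k assume "k \<in> K"
      then show "k \<in> J"
        using JI[of "[:k:]" 1 k] is_subringD[OF Ps] is_subringD[OF Ks] one_notin_M by (simp add: polys_over_0)
    qed
    ultimately have "J = K" by (rule K(2))
    moreover have "e \<in> J"
      using JI[of "[:0, 1:]" 1 e] is_subringD[OF Ps] is_subringD[OF Ks] one_notin_M by (simp add: polys_over_0)
    moreover have "d - e \<in> M" using is_idealD(5)[OF M_ideal e] by simp
    ultimately show ?thesis by blast
  qed
  have "\<exists>!k. k \<in> K \<and> d - k \<in> M" for d
  proof -
    obtain k where k: "k \<in> K" "d - k \<in> M" using ex by blast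
    show ?thesis
    proof (rule ex1I[of _ k])
      fix l assume l: "l \<in> K \<and> d - l \<in> M"
      then have "(d - k) - (d - l) \<in> M" using is_idealD(6)[OF M_ideal k(2)] by blast
      then have "l - k \<in> M" by simp
      moreover have "l - k \<in> K" using l k is_subringD[OF Ks] by blast
      ultimately have "l - k = 0" using subfield_Int_M[OF K(1)] by blast
      then show "l = k" by simp
    qed (use k in blast)
  qed
  then show ?thesis using K(1) by (auto simp: coefficient_field_def)
qed

end

section \<open>Comparability of elements under divisibility\<close>

text \<open>\<open>K[x]\<close> is a field for algebraic \<open>x\<close>. The polynomial
  \<open>h\<close> of least degree with \<open>poly h x\<close> in \<open>poly g x * K[x]\<close> is
  the gcd of \<open>g\<close> and the minimal polynomial; it does not vanish at \<open>x\<close>, so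
  it is constant.\<close>

lemma subfield_adjoin_inverse:
  fixes x :: "'a::field"
  assumes K: "is_subfield K" and F: "F \<in> polys_over K" "F \<noteq> 0" "poly F x = 0"
    and g: "g \<in> polys_over K" "poly g x \<noteq> 0"
  obtains p where "p \<in> polys_over K" "poly g x * poly p x = 1"
proof -
  have Ks: "is_subring K" by (rule is_subfield_imp_subring[OF K])
  have Ps: "is_subring (polys_over K)" by (rule is_subring_polys_over[OF Ks])
  have I: "is_ideal {0::'a}" by (auto simp: is_ideal_def)
  obtain f where f: "f \<in> polys_over K" "lead_coeff f = 1" "poly f x \<in> {0}"
    and min: "\<And>h. h \<in> polys_over K \<Longrightarrow> poly h x \<in> {0} \<Longrightarrow> \<exists>q\<in>polys_over K. h = f * q"
    using exists_minimal_poly_mod_ideal[OF K I F(1,2)] F(3) by blast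
  define Z where "Z = (\<lambda>h. h \<in> polys_over K \<and> h \<noteq> 0 \<and> (\<exists>p\<in>polys_over K. poly h x = poly g x * poly p x))"
  have "Z g" using g is_subringD(2)[OF Ps] by (auto simp: Z_def intro!: bexI[of _ 1])
  then obtain h where h: "Z h" "\<And>h'. Z h' \<Longrightarrow> degree h \<le> degree h'"
    using ex_has_least_nat[of Z _ degree] by blast
  obtain p where p: "p \<in> polys_over K" "poly h x = poly g x * poly p x" using h(1) by (auto simp: Z_def)
  have dvd: "\<exists>q\<in>polys_over K. u = h * q"
    if u: "u \<in> polys_over K" "p' \<in> polys_over K" "poly u x = poly g x * poly p' x" for u p'
  proof -
    obtain q r where qr: "q \<in> polys_over K" "r \<in> polys_over K" "u = h * q + r" "r = 0 \<or> degree r < degree h"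
      using polys_over_divmod[OF K _ _ u(1), of h] h(1) by (auto simp: Z_def)
    have "poly r x = poly g x * poly (p' - p * q) x"
      using u(3) p(2) by (simp add: qr(3) algebra_simps)
    moreover have "p' - p * q \<in> polys_over K" by (intro is_subringD[OF Ps] u p qr)
    ultimately have "r \<noteq> 0 \<Longrightarrow> Z r" using qr(2) unfolding Z_def by blast
    then have "\<not> (r \<noteq> 0 \<and> degree r < degree h)" using h(2)[of r] by auto
    then show ?thesis using qr by auto
  qed
  have "poly f x = poly g x * poly 0 x" using f(3) by simp
  then obtain q where q: "q \<in> polys_over K" "f = h * q" using dvd[OF f(1) is_subringD(1)[OF Ps]] by blast
  obtain s where s: "g = h * s" using dvd[OF g(1) is_subringD(2)[OF Ps]] by auto
  have "poly h x \<noteq> 0" using s g(2) by auto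
  then have "poly q x \<in> {0}" using q(2) f(3) by simp
  \<comment> \<open>In \<open>f = h * q\<close> the root \<open>x\<close> belongs to
    \<open>q\<close>, so \<open>q\<close> is again a multiple of \<open>f\<close>; cancelling
    \<open>f\<close> leaves \<open>h * q' = 1\<close>.\<close>
  then obtain q' where q': "q = f * q'" using min[OF q(1)] by blast
  have "f * (h * q') = h * (f * q')" by (rule mult.left_commute)
  then have "f * (h * q') = f" by (simp only: q(2)[symmetric] q'[symmetric])
  then have hq': "h * q' = 1" using f(2) by (metis leading_coeff_0_iff mult_cancel_left2 zero_neq_one)
  then have "h \<noteq> 0" "q' \<noteq> 0" by auto
  then have "degree h + degree q' = degree (1::'a poly)" by (simp flip: hq' add: degree_mult_eq)
  then have "degree h = 0" by simp
  then obtain c where c: "h = [:c:]" by (metis degree_eq_zeroE)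
  then have "c \<in> K" "c \<noteq> 0" using h(1) by (auto simp: Z_def)
  then obtain b where b: "b \<in> K" "c * b = 1" using K by (auto simp: is_subfield_def)
  show thesis
  proof (rule that[of "smult b p"])
    show "smult b p \<in> polys_over K" using b p(1) by (auto simp: polys_over_def intro: is_subringD[OF Ks])
    show "poly g x * poly (smult b p) x = 1" using p(2) b(2) by (simp add: c mult.left_commute mult.commute)
  qed
qed

lemma right_inverse_unique: "a * b = 1 \<Longrightarrow> a * c = 1 \<Longrightarrow> c = b" for a :: "'a::idom"
  by (metis mult_cancel_left mult_zero_left zero_neq_one)

text \<open>For a pair, the API condition gives \<open>a ^ n = c * \<alpha>\<close> and
  \<open>b ^ n = c * \<beta>\<close> with \<open>c\<close> a combination of both powers. Cancelling
  \<open>c\<close> yields \<open>1 = s * \<alpha> + t * \<beta>\<close>, so one cofactor is a unit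
  because the nonunits lie in the proper ideal \<open>M\<close>.\<close>

lemma API_imp_AV:
  fixes M :: "'a::idom set"
  assumes "API_domain TYPE('a)" and unit: "\<And>x. x \<in> M \<or> x dvd 1" and M: "is_ideal M" "1 \<notin> M"
  shows "AV_domain TYPE('a)"
  unfolding AV_domain_def
proof (intro allI impI)
  fix a b :: 'a
  assume ab: "a \<noteq> 0 \<and> b \<noteq> 0"
  then obtain n c where n: "n > 0" and c: "ideal_gen ((\<lambda>d. d ^ n) ` {a, b}) = ideal_gen {c}"
    using assms(1)[unfolded API_domain_def, rule_format, of "{a, b}"] by (auto simp: is_principal_ideal_def)
  have "a ^ n \<in> ideal_gen {c}" "b ^ n \<in> ideal_gen {c}"
    unfolding c[symmetric] using ideal_gen_superset[of "(\<lambda>d. d ^ n) ` {a, b}"] by auto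
  then obtain \<alpha> \<beta> where ab_c: "a ^ n = c * \<alpha>" "b ^ n = c * \<beta>" by (auto simp: ideal_gen_singleton elim!: dvdE)
  have c0: "c \<noteq> 0" using ab_c(1) ab by auto
  define J where "J = {s * a ^ n + t * b ^ n | s t. True}"
  have "is_ideal J"
    unfolding is_ideal_def
  proof (intro conjI ballI allI)
    show "0 \<in> J" unfolding J_def by (auto intro!: exI[of _ 0])
    fix x y assume "x \<in> J" "y \<in> J"
    then obtain s t s' t' where "x = s * a ^ n + t * b ^ n" "y = s' * a ^ n + t' * b ^ n" by (auto simp: J_def)
    then have "x + y = (s + s') * a ^ n + (t + t') * b ^ n" by (simp add: algebra_simps)
    then show "x + y \<in> J" unfolding J_def by blast
  next
    fix r x assume "x \<in> J"
    then obtain s t where "x = s * a ^ n + t * b ^ n" by (auto simp: J_def)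
    then have "r * x = (r * s) * a ^ n + (r * t) * b ^ n" by (simp add: algebra_simps)
    then show "r * x \<in> J" unfolding J_def by blast
  qed
  moreover have "(\<lambda>d. d ^ n) ` {a, b} \<subseteq> J"
  proof -
    have "a ^ n = 1 * a ^ n + 0 * b ^ n" "b ^ n = 0 * a ^ n + 1 * b ^ n" by simp_all
    then show ?thesis unfolding J_def by blast
  qed
  ultimately have "ideal_gen {c} \<subseteq> J" unfolding c[symmetric] by (rule ideal_gen_least)
  then have "c \<in> J" using ideal_gen_superset[of "{c}"] by auto
  then obtain s t where "c = s * a ^ n + t * b ^ n" by (auto simp: J_def)
  then have "c * 1 = c * (s * \<alpha> + t * \<beta>)" unfolding ab_c by (simp add: algebra_simps)
  then have 1: "1 = s * \<alpha> + t * \<beta>" using c0 by (simp only: mult_cancel_left) auto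
  have "\<not> (\<alpha> \<in> M \<and> \<beta> \<in> M)" using 1 M(2) is_idealD(2,3)[OF M(1)] by metis
  then have "\<alpha> dvd 1 \<or> \<beta> dvd 1" using unit by blast
  then show "\<exists>n>0. a ^ n dvd b ^ n \<or> b ^ n dvd a ^ n"
  proof
    assume "\<alpha> dvd 1"
    then obtain \<gamma> where "1 = \<alpha> * \<gamma>" by (elim dvdE)
    then have "b ^ n = a ^ n * (\<gamma> * \<beta>)" unfolding ab_c by (metis mult.assoc mult_1_right mult.commute)
    then show ?thesis using n by (metis dvd_triv_left)
  next
    assume "\<beta> dvd 1"
    then obtain \<gamma> where "1 = \<beta> * \<gamma>" by (elim dvdE)
    then have "a ^ n = b ^ n * (\<gamma> * \<alpha>)" unfolding ab_c by (metis mult.assoc mult_1_right mult.commute)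
    then show ?thesis using n by (metis dvd_triv_left)
  qed
qed

section \<open>Roots in the fraction field\<close>

context complete_local_domain
begin

definition emb :: "'a \<Rightarrow> 'a fract" where "emb a = Fract a 1"

lemma emb_simps [simp]:
  "emb 0 = 0" "emb 1 = 1" "emb (a + b) = emb a + emb b" "emb (a - b) = emb a - emb b"
  "emb (a * b) = emb a * emb b" "emb (a ^ n) = emb a ^ n" "emb a = emb b \<longleftrightarrow> a = b" "emb a = 0 \<longleftrightarrow> a = 0"
  "emb (of_nat k) = of_nat k" "emb (of_int i) = of_int i"
proof -
  show 0: "emb 0 = 0" "emb 1 = 1" by (simp_all add: emb_def Zero_fract_def One_fract_def)
  show add: "emb (a + b) = emb a + emb b" "emb (a - b) = emb a - emb b" "emb (a * b) = emb a * emb b" for a b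
    by (simp_all add: emb_def)
  show "emb (a ^ n) = emb a ^ n" by (induction n) (simp_all add: 0 add)
  show inj: "emb a = emb b \<longleftrightarrow> a = b" for a b by (simp add: emb_def eq_fract)
  show "emb a = 0 \<longleftrightarrow> a = 0" using inj[of a 0] 0 by simp
  show nat: "emb (of_nat k) = of_nat k" for k by (simp add: emb_def of_nat_fract)
  have "emb (- a) = - emb a" for a by (simp add: emb_def)
  then show "emb (of_int i) = of_int i" by (cases i rule: int_cases2) (simp_all add: nat)
qed

lemma is_subring_range_emb: "is_subring (range emb)"
  unfolding is_subring_def
  by (auto simp flip: emb_simps(3-5)) (metis emb_simps(1,2) rangeI)+

lemma emb_mem_image_iff: "emb a \<in> emb ` A \<longleftrightarrow> a \<in> A"
  by auto

lemma prime_ideal_of_emb_M: "prime_ideal_of (range emb) (emb ` M)"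
  unfolding prime_ideal_of_def ideal_of_def
proof (intro conjI ballI impI)
  show "0 \<in> emb ` M" using emb_mem_image_iff[of 0] is_idealD(1)[OF M_ideal] by simp
  show "1 \<notin> emb ` M" using emb_mem_image_iff[of 1] one_notin_M by simp
qed (auto simp: emb_mem_image_iff M_prime simp flip: emb_simps(3,5) intro: is_idealD[OF M_ideal])

text \<open>The AV condition as a property of a single fraction, applicable to \<open>1 + x\<close>
  and \<open>x - of_int i\<close> without choosing numerators.\<close>

definition power_valued :: bool where
  "power_valued \<longleftrightarrow> (\<forall>z::'a fract. \<exists>m>0. z ^ m \<in> range emb \<or> inverse z ^ m \<in> range emb)"

lemma AV_imp_power_valued:
  assumes "AV_domain TYPE('a)" shows power_valued
  unfolding power_valued_def
proof
  fix z :: "'a fract"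
  obtain a b where z: "z = Fract a b" "b \<noteq> 0" by (cases z)
  show "\<exists>m>0. z ^ m \<in> range emb \<or> inverse z ^ m \<in> range emb"
  proof (cases "a = 0")
    case True
    then have "z ^ 1 = emb 0" using z by (simp add: Zero_fract_def eq_fract)
    then show ?thesis by (intro exI[of _ 1]) auto
  next
    case False
    then obtain n where n: "n > 0" "a ^ n dvd b ^ n \<or> b ^ n dvd a ^ n"
      using assms z(2) by (auto simp: AV_domain_def)
    have zz: "z = emb a / emb b" using z by (simp add: emb_def)
    have nz: "emb a \<noteq> 0" "emb b \<noteq> 0" using False z(2) by auto
    from n(2) have "z ^ n \<in> range emb \<or> inverse z ^ n \<in> range emb"
    proof
      assume "a ^ n dvd b ^ n"
      then obtain k where "emb (b ^ n) = emb (a ^ n * k)" by (metis dvdE)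
      then have "inverse z ^ n = emb k" using nz by (simp add: zz power_divide field_simps)
      then show ?thesis by blast
    next
      assume "b ^ n dvd a ^ n"
      then obtain k where "emb (a ^ n) = emb (b ^ n * k)" by (metis dvdE)
      then have "z ^ n = emb k" using nz by (simp add: zz power_divide field_simps)
      then show ?thesis by blast
    qed
    then show ?thesis using n(1) by blast
  qed
qed

text \<open>Here \<open>1 + x\<close> has a power in the domain, congruent to \<open>1\<close>. By Hensel's lemma this power has a root
  in the domain, which can differ from \<open>1 + x\<close> only by a root of unity congruent to \<open>1\<close>, i.e.\ not at all.\<close>

lemma root_of_nonunit_in_domain:
  assumes pv: power_valued and x: "x ^ n = emb c" and n: "n > 0" and c: "c \<in> M"
  shows "x \<in> range emb"
\<comment> \<open>Treated apart because \<open>inverse 0 = 0\<close>, whereas below a power of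
  \<open>1 + x\<close> may have to be recovered from its inverse.\<close>
proof (cases "1 + x = 0")
  case True
  then have "x = emb (0 - 1)" unfolding emb_simps by (simp add: eq_neg_iff_add_eq_0 add.commute)
  then show ?thesis by blast
next
  case False
  define R where "R = range emb"
  define A where "A = ring_adjoin R x"
  have R: "is_subring R" unfolding R_def by (rule is_subring_range_emb)
  have A: "is_subring A" unfolding A_def by (rule is_subring_ring_adjoin[OF R])
  have RA: "emb a \<in> A" for a unfolding A_def by (rule ring_adjoin_base[OF is_subringD(1)[OF R]]) (simp add: R_def)
  have xA: "x \<in> A" unfolding A_def by (rule ring_adjoin_gen[OF R])
  have xR: "x ^ n \<in> R" using x by (simp add: R_def)
  obtain P where P: "ideal_of A P" "emb ` M \<subseteq> P" "P \<inter> R \<subseteq> emb ` M"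
    and rad: "\<And>z N. z \<in> A \<Longrightarrow> z ^ N \<in> P \<Longrightarrow> z \<in> P"
    using lying_over_radical_ideal[OF R _ n xR] prime_ideal_of_emb_M unfolding R_def A_def by metis
  have emb_P: "emb a \<in> P \<Longrightarrow> a \<in> M" for a using P(3) by (auto simp: R_def)
  have P_emb: "a \<in> M \<Longrightarrow> emb a \<in> P" for a using P(2) by auto
  have "x ^ n \<in> P" using P_emb[OF c] x by simp
  then have xP: "x \<in> P" by (rule rad[OF xA])
  have mult1: "y * z - 1 \<in> P" if "y \<in> A" "y - 1 \<in> P" "z - 1 \<in> P" for y z
  proof -
    have "y * (z - 1) + (y - 1) \<in> P" by (intro ideal_ofD(4)[OF P(1)] ideal_ofD(5)[OF P(1)] that)
    then show ?thesis by (simp add: algebra_simps)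
  qed
  have pow1: "y ^ k - 1 \<in> P" if "y \<in> A" "y - 1 \<in> P" for y k
    using ideal_ofD(3)[OF P(1)] that by (induction k) (auto intro!: mult1)
  have x1A: "1 + x \<in> A" by (intro is_subringD[OF A] xA)
  have x1P: "(1 + x) - 1 \<in> P" using xP by simp
  obtain m where m: "m > 0" "(1 + x) ^ m \<in> range emb \<or> inverse (1 + x) ^ m \<in> range emb"
    using pv unfolding power_valued_def by blast
  obtain d where d: "(1 + x) ^ m = emb d"
  proof -
    \<comment> \<open>If it is the inverse that has a power \<open>w\<close> in the domain, then
      \<open>w\<close> is congruent to \<open>1\<close> modulo \<open>P\<close>, hence a unit, and
      its inverse is the power wanted.\<close>
    have "\<exists>d. (1 + x) ^ m = emb d" if w: "inverse (1 + x) ^ m = emb w" for w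
    proof -
      have w1: "emb w * (1 + x) ^ m = 1" using False by (simp flip: w power_mult_distrib)
      have "emb (w - 1) = 0 - emb w * ((1 + x) ^ m - 1)" using w1 by (simp add: right_diff_distrib)
      also have "\<dots> \<in> P"
        by (intro ideal_of_diff[OF A P(1)] ideal_ofD(3)[OF P(1)] ideal_ofD(5)[OF P(1) RA] pow1 x1A x1P)
      finally have "w - 1 \<in> M" by (rule emb_P)
      then have "w \<notin> M" by (rule notin_M_add[OF one_notin_M])
      then obtain v where "w * v = 1" using unit_inverse by blast
      then have "emb w * emb v = 1" by (metis emb_simps(2,5))
      then have "(1 + x) ^ m = emb v" by (rule right_inverse_unique) (rule w1)
      then show ?thesis by blast
    qed
    then show thesis using m(2) that by blast
  qed
  have "emb (d - 1) \<in> P" using pow1[OF x1A x1P, of m] d by simp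
  then have "d - 1 \<in> M" by (rule emb_P)
  then obtain u where u: "u ^ m = d" "u - 1 \<in> M" using nth_root_near_1 m(1) by blast
  have u1P: "emb u - 1 \<in> P" using P_emb[OF u(2)] by simp
  \<comment> \<open>The cofactor of \<open>(1 + x) - emb u\<close> in the difference of the
    \<open>m\<close>-th powers, which is zero. Its \<open>m\<close> terms are congruent to
    \<open>1\<close> modulo \<open>P\<close>, so \<open>S\<close> is congruent to
    \<open>of_nat m\<close> and cannot vanish.\<close>
  define S where "S = (\<Sum>j<m. (1 + x) ^ j * emb u ^ (m - Suc j))"
  have "S - of_nat m = (\<Sum>j<m. (1 + x) ^ j * emb u ^ (m - Suc j) - 1)"
    by (simp add: S_def sum_subtractf)
  also have "\<dots> \<in> P"
    by (intro ideal_of_sum[OF P(1)] mult1 pow1 is_subring_power[OF A] x1A x1P RA u1P)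
  finally have S: "S - of_nat m \<in> P" .
  have S0: "S \<noteq> 0"
  proof
    assume "S = 0"
    then have "0 - (S - of_nat m) = emb (of_nat m)" by simp
    moreover have "0 - (S - of_nat m) \<in> P" by (intro ideal_of_diff[OF A P(1)] ideal_ofD(3)[OF P(1)] S)
    ultimately have "of_nat m \<in> M" using emb_P by metis
    then show False using of_nat_notin_M[OF m(1)] by blast
  qed
  have "((1 + x) - emb u) * S = (1 + x) ^ m - emb u ^ m"
    unfolding S_def by (subst power_diff_sumr2) (simp only: mult.commute)
  also have "\<dots> = 0" by (simp only: d u(1)[symmetric] emb_simps diff_self)
  finally have "(1 + x) - emb u = 0" using S0 by simp
  then have "x = emb (u - 1)" by (simp add: algebra_simps)
  then show ?thesis by blast
qed

text \<open>After a normalisation by Hensel's lemma a power of \<open>x\<close> lies in the coefficient field \<open>K\<close>. Then all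
  translates of \<open>x\<close> by integers also have powers in \<open>K\<close>.\<close>

lemma root_of_unit_in_domain:
  assumes pv: power_valued and K: "coefficient_field M K"
    and y: "y ^ n = emb c" and n: "n > 0" and c: "c \<notin> M"
  shows "y \<in> range emb"
proof -
  have Kf: "is_subfield K" using K by (simp add: coefficient_field_def)
  \<comment> \<open>\<open>\<kappa>\<close> represents \<open>c\<close> in \<open>K\<close>. The
    quotient \<open>c * \<kappa>'\<close> is congruent to \<open>1\<close> and has an
    \<open>n\<close>-th root \<open>v\<close>, so that \<open>x\<close>, the quotient of
    \<open>y\<close> by \<open>emb v\<close>, satisfies \<open>x ^ n = emb \<kappa>\<close>.\<close>
  obtain \<kappa> where \<kappa>: "\<kappa> \<in> K" "c - \<kappa> \<in> M" using K unfolding coefficient_field_def by blast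
  have "\<kappa> \<notin> M" using notin_M_add[OF c, of \<kappa>] is_idealD(5)[OF M_ideal \<kappa>(2)] by simp
  then obtain \<kappa>' where \<kappa>': "\<kappa> * \<kappa>' = 1" using unit_inverse by blast
  have "(c - \<kappa>) * \<kappa>' \<in> M" by (rule is_idealD(4)[OF M_ideal \<kappa>(2)])
  then have "c * \<kappa>' - 1 \<in> M" by (simp add: left_diff_distrib \<kappa>')
  then obtain v where v: "v ^ n = c * \<kappa>'" "v - 1 \<in> M" using nth_root_near_1 n by blast
  have "v \<notin> M" by (rule notin_M_add[OF one_notin_M v(2)])
  then obtain v' where v': "v * v' = 1" using unit_inverse by blast
  define x where "x = y * emb v'"
  have "c * v' ^ n = c * (\<kappa> * \<kappa>') * v' ^ n" by (simp only: \<kappa>' mult_1_right)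
  also have "\<dots> = \<kappa> * ((c * \<kappa>') * v' ^ n)" by (simp only: mult_ac)
  also have "\<dots> = \<kappa> * (v * v') ^ n" by (simp only: v(1)[symmetric] power_mult_distrib)
  finally have cv': "c * v' ^ n = \<kappa>" by (simp add: v')
  have "x ^ n = emb (c * v' ^ n)" by (simp only: x_def power_mult_distrib y emb_simps)
  then have x: "x ^ n = emb \<kappa>" by (simp only: cv')
  define R where "R = range emb"
  define A where "A = ring_adjoin R x"
  have R: "is_subring R" unfolding R_def by (rule is_subring_range_emb)
  have A: "is_subring A" unfolding A_def by (rule is_subring_ring_adjoin[OF R])
  have RA: "emb a \<in> A" for a unfolding A_def by (rule ring_adjoin_base[OF is_subringD(1)[OF R]]) (simp add: R_def)
  have xA: "x \<in> A" unfolding A_def by (rule ring_adjoin_gen[OF R])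
  have xR: "x ^ n \<in> R" using x by (simp add: R_def)
  obtain P where P: "ideal_of A P" "emb ` M \<subseteq> P" "P \<inter> R \<subseteq> emb ` M"
    using lying_over_radical_ideal[OF R _ n xR] prime_ideal_of_emb_M unfolding R_def A_def by metis
  have P_emb: "a \<in> M \<Longrightarrow> emb a \<in> P" for a using P(2) by auto
  have P1: "1 \<notin> P"
    using P(3) is_subringD(2)[OF R] prime_ideal_of_emb_M by (auto simp: prime_ideal_of_def)
  define L where "L = emb ` K"
  have Kr: "is_subring K" by (rule is_subfield_imp_subring[OF Kf])
  have L: "is_subfield L"
    unfolding is_subfield_def L_def
  proof (intro conjI ballI impI)
    show "0 \<in> emb ` K" using emb_mem_image_iff[of 0] is_subringD[OF Kr] by simp
    show "1 \<in> emb ` K" using emb_mem_image_iff[of 1] is_subringD[OF Kr] by simp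
    show "\<exists>w\<in>emb ` K. z * w = 1" if z: "z \<in> emb ` K" "z \<noteq> 0" for z
    proof -
      obtain k where k: "k \<in> K" "z = emb k" using z(1) by blast
      then obtain k' where "k' \<in> K" "k * k' = 1" using z(2) Kf by (auto simp: is_subfield_def)
      then show ?thesis using k by (metis emb_simps(2,5) imageI)
    qed
  qed (auto simp: emb_mem_image_iff simp flip: emb_simps(3-5) intro: is_subringD[OF Kr])
  have Lr: "is_subring L" by (rule is_subfield_imp_subring[OF L])
  have Ps: "is_subring (polys_over L)" by (rule is_subring_polys_over[OF Lr])
  have LR: "polys_over L \<subseteq> polys_over R" by (auto simp: L_def R_def polys_over_def)
  define F where "F = monom 1 n - [:emb \<kappa>:]"
  have F: "F \<in> polys_over L" "F \<noteq> 0" "poly F x = 0"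
  proof -
    have "emb \<kappa> \<in> L" using \<kappa>(1) by (simp add: L_def)
    then have "[:emb \<kappa>:] \<in> polys_over L" by (simp add: polys_over_0 is_subringD(1)[OF Lr])
    then show "F \<in> polys_over L" unfolding F_def
      by (intro is_subringD(4)[OF Ps] polys_over_monom is_subringD(1,2)[OF Lr])
    have "coeff F n = 1" using n by (cases n) (auto simp: F_def)
    then show "F \<noteq> 0" by auto
    show "poly F x = 0" using x by (simp add: F_def poly_monom)
  qed
  have char: "of_nat k \<noteq> (0::'a fract)" if "k > 0" for k
    using of_nat_notin_M[OF that] is_idealD(1)[OF M_ideal] emb_simps(8)[of "of_nat k"] by auto
  have "\<exists>N>0. (x - of_int i) ^ N \<in> L" for i
  proof (cases "x - of_int i = 0")
    case True
    then show ?thesis using is_subringD(1)[OF Lr] by (intro exI[of _ 1]) simp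
  next
    case False
    have zA: "x - of_int i \<in> A" by (intro is_subringD[OF A] xA is_subring_of_int[OF A])
    obtain m where m: "m > 0" "(x - of_int i) ^ m \<in> range emb \<or> inverse (x - of_int i) ^ m \<in> range emb"
      using pv unfolding power_valued_def by blast
    obtain d where d: "(x - of_int i) ^ m = emb d"
    proof -
      have "\<exists>d. (x - of_int i) ^ m = emb d" if w: "inverse (x - of_int i) ^ m = emb w" for w
      proof -
        have w1: "emb w * (x - of_int i) ^ m = 1" using False by (simp flip: w power_mult_distrib)
        have "w \<notin> M"
        proof
          assume "w \<in> M"
          then have "emb w * (x - of_int i) ^ m \<in> P"
            by (intro ideal_ofD(6)[OF P(1)] is_subring_power[OF A] zA P_emb)
          then show False using w1 P1 by simp
        qed
        then obtain v where "w * v = 1" using unit_inverse by blast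
        then have "emb w * emb v = 1" by (metis emb_simps(2,5))
        then have "(x - of_int i) ^ m = emb v" by (rule right_inverse_unique) (rule w1)
        then show ?thesis by blast
      qed
      then show thesis using m(2) that by blast
    qed
    obtain k where k: "k \<in> K" "d - k \<in> M" using K unfolding coefficient_field_def by blast
    \<comment> \<open>The value \<open>poly g x = emb (d - k)\<close> lies in \<open>P\<close> and
      in the field \<open>L[x]\<close>. If it were nonzero, it would have an inverse in
      \<open>A\<close>, forcing \<open>1 \<in> P\<close>. Hence \<open>d = k\<close> is in
      \<open>K\<close>.\<close>
    define g where "g = [:- of_int i, 1:] ^ m - [:emb k:]"
    have gx: "poly g x = emb (d - k)" using d by (simp add: g_def)
    have "d - k = 0"
    proof (rule ccontr)
      assume "d - k \<noteq> 0"
      then have g0: "poly g x \<noteq> 0" unfolding gx emb_simps(8) .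
      have "emb k \<in> L" using k(1) by (simp add: L_def)
      then have "[:emb k:] \<in> polys_over L" "[:- of_int i, 1:] \<in> polys_over L"
        by (simp_all add: polys_over_0 is_subringD[OF Lr] is_subring_of_int[OF Lr])
      then have gL: "g \<in> polys_over L" unfolding g_def
        by (intro is_subringD(4)[OF Ps] is_subring_power[OF Ps])
      obtain p where p: "p \<in> polys_over L" "poly g x * poly p x = 1"
        using subfield_adjoin_inverse[OF L F gL g0] by blast
      have "poly p x \<in> A" using p(1) LR by (auto simp: A_def ring_adjoin_def)
      then have "poly g x * poly p x \<in> P" unfolding gx by (intro ideal_ofD(6)[OF P(1)] P_emb k(2))
      then show False using p(2) P1 by simp
    qed
    then have "(x - of_int i) ^ m \<in> L" using d k(1) by (simp add: L_def)
    then show ?thesis using m(1) by blast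
  qed
  then have "x \<in> L" using in_subfield_if_translates_power_in_subfield[OF char L] by blast
  then obtain k where k: "x = emb k" by (auto simp: L_def)
  have "x * emb v = y * emb (v * v')" by (simp only: x_def emb_simps mult_ac)
  then have "y = x * emb v" by (simp add: v')
  then have "y = emb (k * v)" by (simp add: k)
  then show ?thesis by blast
qed

text \<open>If \<open>a ^ n\<close> divides \<open>b ^ n\<close>, then the fraction
  \<open>b / a\<close> has a power \<open>c\<close> in the domain; the two preceding results, for
  \<open>c\<close> a nonunit and a unit, put \<open>b / a\<close> itself there.\<close>

theorem AV_imp_dvd_total:
  assumes "AV_domain TYPE('a)"
  shows "(a::'a) dvd b \<or> b dvd a"
proof (cases "a = 0 \<or> b = 0")
  case True
  then show ?thesis by auto
next
  case False
  obtain K where K: "coefficient_field M K" using exists_coefficient_field by blast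
  have pv: power_valued by (rule AV_imp_power_valued[OF assms])
  have key: "a dvd b" if ab: "a \<noteq> 0" "a ^ n dvd b ^ n" "n > 0" for a b :: 'a and n
  proof -
    obtain c where c: "b ^ n = a ^ n * c" using ab(2) by (elim dvdE)
    have "emb a \<noteq> 0" using ab(1) by simp
    moreover have "emb (b ^ n) = emb (a ^ n * c)" by (simp only: c)
    then have "emb b ^ n = emb a ^ n * emb c" by (simp only: emb_simps)
    ultimately have "(emb b / emb a) ^ n = emb c" by (simp add: power_divide)
    then have "emb b / emb a \<in> range emb"
      using root_of_nonunit_in_domain[OF pv _ ab(3)] root_of_unit_in_domain[OF pv K _ ab(3)] by blast
    then obtain k where "emb b / emb a = emb k" by blast
    then have "emb b = emb (a * k)" using \<open>emb a \<noteq> 0\<close> by (simp add: field_simps)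
    then have "b = a * k" by (rule iffD1[OF emb_simps(7)])
    then show ?thesis by simp
  qed
  obtain n where "n > 0" "a ^ n dvd b ^ n \<or> b ^ n dvd a ^ n" using False assms by (auto simp: AV_domain_def)
  then show ?thesis using key[of a n b] key[of b n a] False by blast
qed


end

section \<open>The discrete valuation ring and the power series ring\<close>

lemma finite_dvd_total_least:
  fixes S :: "'a::comm_ring_1 set"
  assumes "finite S" "S \<noteq> {}" and total: "\<And>a b::'a. a dvd b \<or> b dvd a"
  shows "\<exists>s\<in>S. \<forall>x\<in>S. s dvd x"
  using assms(1,2)
proof (induction S rule: finite_ne_induct)
  case (insert x S)
  then obtain s where s: "s \<in> S" "\<forall>y\<in>S. s dvd y" by blast
  show ?case
  proof (cases "s dvd x")
    case True
    then show ?thesis using s by auto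
  next
    case False
    then have "x dvd s" using total by blast
    then have "\<forall>y\<in>insert x S. x dvd y" using s(2) dvd_trans[of x s] by auto
    then show ?thesis by blast
  qed
qed simp

lemma principal_if_dvd_total:
  assumes noeth: "noetherian_ring TYPE('a::comm_ring_1)"
    and total: "\<And>a b::'a. a dvd b \<or> b dvd a" and I: "is_ideal (I :: 'a set)"
  shows "is_principal_ideal I"
proof -
  obtain S where S: "finite S" "I = ideal_gen S" using noeth I by (auto simp: noetherian_ring_def)
  show ?thesis
  proof (cases "S = {}")
    case True
    have "ideal_gen {} = {0::'a}"
    proof
      show "ideal_gen {} \<subseteq> {0::'a}" by (rule ideal_gen_least) (auto simp: is_ideal_def)
      show "{0::'a} \<subseteq> ideal_gen {}" using is_idealD(1)[OF is_ideal_ideal_gen] by auto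
    qed
    also have "\<dots> = ideal_gen {0}" by (simp add: ideal_gen_singleton)
    finally show ?thesis using S(2) True by (auto simp: is_principal_ideal_def)
  next
    case False
    then obtain s where s: "s \<in> S" "\<And>x. x \<in> S \<Longrightarrow> s dvd x"
      using finite_dvd_total_least[OF S(1) _ total] by blast
    have "ideal_gen S = ideal_gen {s}"
    proof
      show "ideal_gen S \<subseteq> ideal_gen {s}"
        by (rule ideal_gen_least[OF is_ideal_ideal_gen]) (use s in \<open>auto simp: ideal_gen_singleton\<close>)
      show "ideal_gen {s} \<subseteq> ideal_gen S"
        by (rule ideal_gen_least[OF is_ideal_ideal_gen]) (use s ideal_gen_superset[of S] in auto)
    qed
    then show ?thesis using S(2) by (auto simp: is_principal_ideal_def)
  qed
qed

lemma ideal_pow_principal: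
  assumes "M = ideal_gen {t::'a::comm_ring_1}"
  shows "ideal_pow M k = {x. t ^ k dvd x}"
proof
  have "t ^ length xs dvd prod_list xs" if "set xs \<subseteq> M" for xs
    using that by (induction xs) (auto simp: assms ideal_gen_singleton intro: mult_dvd_mono)
  then show "ideal_pow M k \<subseteq> {x. t ^ k dvd x}"
    unfolding ideal_pow_def by (intro ideal_gen_least[OF is_ideal_multiples]) auto
  have "set (replicate k t) \<subseteq> M" using ideal_gen_superset[of "{t}"] assms by auto
  from prod_list_in_ideal_pow[OF this] have "t ^ k \<in> ideal_pow M k" by simp
  then show "{x. t ^ k dvd x} \<subseteq> ideal_pow M k"
    by (auto elim!: dvdE intro!: is_idealD(4)[OF is_ideal_ideal_pow])
qed

text \<open>In the product of the truncations, the terms with \<open>i + j < k\<close> add up to the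
  truncation of the product, and every other term carries \<open>t ^ (i + j)\<close> with
  \<open>i + j \<ge> k\<close>.\<close>

lemma fps_truncation_mult:
  fixes t :: "'a::comm_ring_1"
  shows "t ^ k dvd (\<Sum>i<k. fps_nth f i * t ^ i) * (\<Sum>j<k. fps_nth g j * t ^ j)
    - (\<Sum>n<k. fps_nth (f * g) n * t ^ n)"
proof -
  define h where "h = (\<lambda>i j. (fps_nth f i * t ^ i) * (fps_nth g j * t ^ j))"
  have "(\<Sum>n<k. fps_nth (f * g) n * t ^ n) = (\<Sum>n<k. \<Sum>i\<le>n. h i (n - i))"
  proof (rule sum.cong[OF refl])
    fix n
    have "fps_nth f i * fps_nth g (n - i) * t ^ n = h i (n - i)" if "i \<le> n" for i
    proof -
      have "t ^ n = t ^ i * t ^ (n - i)" using that by (simp flip: power_add)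
      then show ?thesis by (simp add: h_def mult_ac)
    qed
    then show "fps_nth (f * g) n * t ^ n = (\<Sum>i\<le>n. h i (n - i))"
      by (simp add: fps_mult_nth atLeast0AtMost sum_distrib_right)
  qed
  also have "\<dots> = (\<Sum>(i, j)\<in>{(i, j). i + j < k}. h i j)" by (rule sum.triangle_reindex[symmetric])
  finally have fg: "(\<Sum>n<k. fps_nth (f * g) n * t ^ n) = (\<Sum>(i, j)\<in>{(i, j). i + j < k}. h i j)" .
  have sub: "{(i, j). i + j < k} \<subseteq> {..<k} \<times> {..<k}" by auto
  have "(\<Sum>i<k. fps_nth f i * t ^ i) * (\<Sum>j<k. fps_nth g j * t ^ j) = (\<Sum>(i, j)\<in>{..<k} \<times> {..<k}. h i j)"
    by (simp add: sum_product sum.cartesian_product h_def)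
  then have "(\<Sum>i<k. fps_nth f i * t ^ i) * (\<Sum>j<k. fps_nth g j * t ^ j)
      - (\<Sum>n<k. fps_nth (f * g) n * t ^ n) = (\<Sum>(i, j)\<in>{..<k} \<times> {..<k} - {(i, j). i + j < k}. h i j)"
    unfolding fg using sub by (simp add: sum_diff)
  also have "t ^ k dvd \<dots>"
  proof (rule dvd_sum)
    fix p assume "p \<in> {..<k} \<times> {..<k} - {(i, j). i + j < k}"
    then obtain i j where p: "p = (i, j)" and "i + j \<ge> k" by auto
    then have "t ^ k dvd t ^ (i + j)" by (intro le_imp_power_dvd) auto
    then have "t ^ k dvd (fps_nth f i * fps_nth g j) * t ^ (i + j)" by (rule dvd_mult)
    then show "t ^ k dvd (case p of (i, j) \<Rightarrow> h i j)" by (simp add: p h_def power_add mult_ac)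
  qed
  finally show ?thesis .
qed

section \<open>Power series in a generator of the maximal ideal\<close>

context complete_local_domain
begin

text \<open>The isomorphism evaluates a series at \<open>t\<close>. It is bijective on
  \<open>fps_over K\<close> because \<open>K\<close> represents each residue class exactly once, so
  the coefficients are digits that can be read off in turn.\<close>

theorem principal_imp_iso_to_power_series:
  assumes t: "M = ideal_gen {t}" "t \<noteq> 0" and K: "coefficient_field M K"
  shows "iso_to_power_series K"
proof -
  have Kf: "is_subfield K" using K by (simp add: coefficient_field_def)
  have Kr: "is_subring K" by (rule is_subfield_imp_subring[OF Kf])
  note pow = ideal_pow_principal[OF t(1)]
  have M: "x \<in> M \<longleftrightarrow> t dvd x" for x by (simp add: t(1) ideal_gen_singleton)
  have sep: "x = 0" if "\<And>k. t ^ k dvd x" for x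
    by (rule ideal_pow_Int_eq) (simp add: pow that)
  define S where "S = (\<lambda>k f. \<Sum>j<k. fps_nth f j * t ^ j)"
  have S_Suc: "S (Suc k) f = S k f + fps_nth f k * t ^ k" for k f by (simp add: S_def)
  have ex: "\<exists>L. \<forall>k. t ^ k dvd L - S k f" for f
  proof -
    have "S (Suc n) f - S n f \<in> ideal_pow M n" for n by (simp add: S_Suc pow)
    then obtain L where L: "\<And>n. S n f - L \<in> ideal_pow M n" using madic_limit[of "\<lambda>n. S n f"] by blast
    have "t ^ k dvd L - S k f" for k
      using L[of k] dvd_minus_iff[of "t ^ k" "S k f - L"] by (simp add: pow)
    then show ?thesis by blast
  qed
  define \<psi> where "\<psi> = (\<lambda>f. SOME L. \<forall>k. t ^ k dvd L - S k f)"
  have \<psi>: "t ^ k dvd \<psi> f - S k f" for k f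
    using someI_ex[OF ex[of f]] by (simp add: \<psi>_def)
  \<comment> \<open>No nonzero element is divisible by all powers of \<open>t\<close>, so these
    congruences determine the chosen limit; the ring laws for \<open>\<psi>\<close> follow from
    them.\<close>
  have \<psi>_eq: "\<psi> f = L" if L: "\<And>k. t ^ k dvd L - S k f" for f L
  proof -
    have "t ^ k dvd \<psi> f - L" for k using dvd_diff[OF \<psi>[of k f] L[of k]] by simp
    then show ?thesis using sep[of "\<psi> f - L"] by simp
  qed
  have one: "\<psi> 1 = 1"
  proof (rule \<psi>_eq)
    fix k
    have "S (Suc n) 1 = 1" for n by (induction n) (simp_all add: S_def)
    then show "t ^ k dvd 1 - S k 1" by (cases k) auto
  qed
  have add: "\<psi> (f + g) = \<psi> f + \<psi> g" for f g
  proof (rule \<psi>_eq)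
    fix k
    have "\<psi> f + \<psi> g - S k (f + g) = (\<psi> f - S k f) + (\<psi> g - S k g)"
      by (simp add: S_def distrib_right sum.distrib)
    also have "t ^ k dvd \<dots>" by (intro dvd_add \<psi>)
    finally show "t ^ k dvd \<psi> f + \<psi> g - S k (f + g)" .
  qed
  have mult: "\<psi> (f * g) = \<psi> f * \<psi> g" for f g
  proof (rule \<psi>_eq)
    fix k
    have "\<psi> f * \<psi> g - S k (f * g) = (\<psi> f - S k f) * \<psi> g + S k f * (\<psi> g - S k g) + (S k f * S k g - S k (f * g))"
      by (simp add: algebra_simps)
    also have "t ^ k dvd \<dots>"
      by (intro dvd_add dvd_mult2[OF \<psi>] dvd_mult[OF \<psi>])
        (use fps_truncation_mult[of t k f g] in \<open>simp only: S_def\<close>)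
    finally show "t ^ k dvd \<psi> f * \<psi> g - S k (f * g)" .
  qed
  have inj: "inj_on \<psi> (fps_over K)"
  proof (rule inj_onI)
    fix f g assume fg: "f \<in> fps_over K" "g \<in> fps_over K" "\<psi> f = \<psi> g"
    have "fps_nth f n = fps_nth g n" for n
    proof (induction n rule: less_induct)
      case (less n)
      then have "S n f = S n g" by (simp add: S_def)
      \<comment> \<open>Modulo \<open>t ^ Suc n\<close> only the terms of index \<open>n\<close> can
        differ. Cancelling \<open>t ^ n\<close> puts the difference of the coefficients into
        \<open>M\<close>, which meets \<open>K\<close> only in \<open>0\<close>.\<close>
      moreover have "t ^ Suc n dvd (\<psi> g - S (Suc n) g) - (\<psi> g - S (Suc n) f)"
        using dvd_diff[OF \<psi>[of "Suc n" g] \<psi>[of "Suc n" f]] by (simp only: fg(3))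
      ultimately have "t ^ n * t dvd t ^ n * (fps_nth f n - fps_nth g n)"
        by (simp add: S_Suc algebra_simps)
      then have "fps_nth f n - fps_nth g n \<in> M" using t(2) M by (simp only: dvd_mult_cancel_left) simp
      moreover have "fps_nth f n - fps_nth g n \<in> K"
        using fg by (intro is_subringD[OF Kr]) (auto simp: fps_over_def)
      ultimately have "fps_nth f n - fps_nth g n = 0" using subfield_Int_M[OF Kf] by blast
      then show ?case by simp
    qed
    then show "f = g" by (simp add: fps_eq_iff)
  qed
  have surj: "\<exists>f\<in>fps_over K. \<psi> f = L" for L
  proof -
    have "\<exists>k r. k \<in> K \<and> d = k + t * r" for d
    proof -
      obtain k where "k \<in> K" "d - k \<in> M" using K unfolding coefficient_field_def by blast
      then show ?thesis unfolding M by (metis add_diff_cancel_left' diff_add_cancel add.commute dvdE)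
    qed
    \<comment> \<open>\<open>c d\<close> is the leading digit of \<open>d\<close> and
      \<open>r d\<close> the quotient of \<open>d - c d\<close> by \<open>t\<close>; iterating
      \<open>r\<close> from \<open>L\<close> yields the successive coefficients.\<close>
    then obtain c r where cr: "\<And>d. c d \<in> K" "\<And>d. d = c d + t * r d" by metis
    define f where "f = Abs_fps (\<lambda>n. c ((r ^^ n) L))"
    have "L = S k f + t ^ k * (r ^^ k) L" for k
    proof (induction k)
      case (Suc k)
      have "t ^ k * (r ^^ k) L = t ^ k * (c ((r ^^ k) L) + t * r ((r ^^ k) L))" using cr(2)[of "(r ^^ k) L"] by simp
      also have "\<dots> = fps_nth f k * t ^ k + t ^ Suc k * (r ^^ Suc k) L" by (simp add: f_def algebra_simps)
      finally show ?case using Suc by (simp add: S_Suc add.assoc)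
    qed (simp add: S_def)
    then have "t ^ k dvd L - S k f" for k by (metis add_diff_cancel_left' dvd_triv_left)
    then have "\<psi> f = L" by (rule \<psi>_eq)
    moreover have "f \<in> fps_over K" using cr(1) by (simp add: f_def fps_over_def)
    ultimately show ?thesis by blast
  qed
  have "bij_betw \<psi> (fps_over K) UNIV" using inj surj unfolding bij_betw_def by (metis UNIV_eq_I imageI)
  then show ?thesis unfolding iso_to_power_series_def using one add mult by blast
qed

end

theorem theorem7:
  fixes M :: "'a::idom set"
  assumes "complete_local_ring M"
    and "\<not> is_field_ring TYPE('a)"
    and "residue_char_zero M"
    and "AV_domain TYPE('a) \<or> API_domain TYPE('a)"
  shows "is_DVR TYPE('a) \<and> (\<exists>K. coefficient_field M K \<and> iso_to_power_series K)"
proof -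
  interpret complete_local_domain M by standard (use assms in auto)
  have AV: "AV_domain TYPE('a)"
    using assms(4) API_imp_AV[OF _ _ M_ideal one_notin_M] unit_iff by blast
  note total = AV_imp_dvd_total[OF AV]
  have noeth: "noetherian_ring TYPE('a)" and unique: "\<And>N. is_maximal_ideal N \<Longrightarrow> N = M"
    using assms(1) by (auto simp: complete_local_ring_def local_ring_with_max_def)
  have principal: "is_principal_ideal I" if "is_ideal I" for I :: "'a set"
    by (rule principal_if_dvd_total[OF noeth total that])
  have DVR: "is_DVR TYPE('a)"
    unfolding is_DVR_def using principal unique maximal assms(2) by blast
  obtain t where t: "M = ideal_gen {t}"
    using principal[OF M_ideal] by (auto simp: is_principal_ideal_def)
  have "t \<noteq> 0"
  proof
    assume "t = 0"
    then have "M = {0}" using t by (simp add: ideal_gen_singleton)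
    then have "is_field_ring TYPE('a)" using unit_iff by (simp add: is_field_ring_def)
    then show False using assms(2) by blast
  qed
  then show ?thesis
    using DVR exists_coefficient_field principal_imp_iso_to_power_series[OF t] by blast
qed

end
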